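(* Let $\beta>0$ and $L>0$. Consider the model $f=R_\phi[u]+\varepsilon$ with unknown $\phi\in L^2_\rho$, and suppose that the forward operator and input assumption and the noise assumption ((B1), and (B2) with constant $\tau$) described in the context hold. (i) If the eigenvalues of the normal operator decay polynomially, $a k^{-2r}\le\lambda_k\le b k^{-2r}$ for all $k\ge1$ with $r>\frac14$ and $b\ge a>0$, then $$\liminf_{M\to\infty}\ \inf_{\widehat\phi}\ \sup_{\phi_*\in H^\beta_\rho(L)}\mathbb E_{\phi_*}\Big[M^{\frac{2\beta r}{2\beta r+2r+1}}\|\widehat\phi-\phi_*\|_{L^2_\rho}^2\Big]\ge 2^{-2\beta r-4}\,a^\beta\,(\tau b^{\beta+1})^{-\frac{2\beta r}{2\beta r+2r+1}}\,L^{\frac{4r+2}{2\beta r+2r+1}} .$$ (ii) If the eigenvalues of the normal operator decay exponentially, $a e^{-rk}\le\lambda_k\le b e^{-rk}$ for all $k\ge1$ with $r>0$ and $b\ge a>0$, then $$\liminf_{M\to\infty}\ \inf_{\widehat\phi}\ \sup_{\phi_*\in H^\beta_\rho(L)}\mathbb E_{\phi_*}\Big[M^{\frac{\beta}{\beta+1}}\|\widehat\phi-\phi_*\|_{L^2_\rho}^2\Big]\ge \frac1{16}\,e^{-\beta r}\Big(\frac ab\Big)^{\beta}\tau^{-\frac{\beta}{\beta+1}}L^{\frac2{\beta+1}} .$$ Here the infimum runs over all $L^2_\rho$-valued estimators $\widehat\phi$ based on the data $\{(u^m,f^m)\}_{m=1}^M$, and $\mathbb E_{\phi_*}$ is the expectation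 when the data are generated from the model with kernel $\phi_*$.
   Context: Setting. $\mathcal S\subset\mathbb R^d$ is compact, $\rho$ is a Borel measure on $\mathcal S$, $L^2_\rho=L^2(\mathcal S,\mathcal B(\mathcal S),\rho)$; $\mathbb X$ is a Banach space, $\mathbb Y$ a (finite- or infinite-dimensional) separable real Hilbert space with inner product $\langle\cdot,\cdot\rangle_{\mathbb Y}$. For every $\phi\in L^2_\rho$, $R_\phi:\mathbb X\to\mathbb Y$ is a measurable, possibly nonlinear, map; $u$ is an $\mathbb X$-valued random variable on a complete probability space $(\Omega,\mathcal F,\mathbb P)$. Forward operator and input assumption. (1) $R_\phi[u]$ is linear in $\phi$ for each $u\in\mathbb X$. (2) The normal operator $\mathcal L:L^2_\rho\to L^2_\rho$ defined by $\langle\mathcal L\phi,\psi\rangle_{L^2_\rho}=\mathbb E[\langle R_\phi[u],R_\psi[u]\rangle_{\mathbb Y}]$ (these expectations being finite) is nonnegative, self-adjoint and compact, with positive eigenvalues $\lambda_1\ge\lambda_2\ge\cdots>0$ (infinitely many, counted with multiplicity) decaying either polynomially ($ak^{-2r}\le\lambda_k\le bk^{-2r}$, $r>1/4$) or exponentially ($ae^{-rk}\le\lambda_k\le be^{-rk}$, $r>0$), with $b\ge a>0$. Let $\{\psi_k\}_{k\ge1}$ be corresponding orthonormal eigenfunctions. Noise assumption. $\varepsilon:\mathbb Y\to L^2(\Omega)$, $y\mapsto\langle\varepsilon,y\rangle$, is a linear map, independent of $u$ (i.e. the family $(\langle\varepsilon,y\rangle)_{y\in\mathbb Y}$ is independent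 of $u$), such that: (B1) $\mathbb E[\langle\varepsilon,y\rangle]=0$ and $\mathbb E[\langle\varepsilon,y\rangle^2]\le\sigma^2\|y\|_{\mathbb Y}^2$ for all $y\in\mathbb Y$, for some constant $\sigma>0$. (B2) For some orthonormal basis $\{y_i\}$ of $\mathbb Y$, for every $N$ (with $N\le\dim\mathbb Y$) the vector $(\langle\varepsilon,y_1\rangle,\dots,\langle\varepsilon,y_N\rangle)$ has a Lebesgue density $p_N$ on $\mathbb R^N$, and there is $\tau>0$, uniform in $N$ and $v$, with $\int_{\mathbb R^N}\log\big(\frac{p_N(x)}{p_N(x+v)}\big)p_N(x)\,dx\le\frac\tau2\|v\|^2$ for all $v\in\mathbb R^N$. Spectral Sobolev spaces. $H^\beta_\rho=\{\phi=\sum_{k\ge1}\theta_k\psi_k:\ \|\phi\|_{H^\beta_\rho}^2=\sum_{k\ge1}\lambda_k^{-\beta}\theta_k^2<\infty\}$ and $H^\beta_\rho(L)=\{\phi\in H^\beta_\rho:\|\phi\|_{H^\beta_\rho}^2\le L^2\}$. Data. $\{(u^m,\varepsilon^m)\}_{m=1}^M$ are i.i.d. copies of $(u,\varepsilon)$ and $f^m=R_{\phi_*}[u^m]+\varepsilon^m$, understood weakly: $\langle f^m,y\rangle=\langle R_{\phi_*}[u^m],y\rangle_{\mathbb Y}+\langle\varepsilon^m,y\rangle$ for all $y\in\mathbb Y$. An estimator is a measurable function, with values in $L^2_\rho$, of the data $u^m$, $(\langle f^m,y_i\rangle)_i$, $m=1,\dots,M$; it does not depend on $\phi_*$ but may depend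 on the known quantities of the model (such as the law of $u$ and the normal operator). *)

theory Defs
  imports "HOL-Probability.Probability"
begin

text \<open>
  Elements of $L^2_\rho$ are represented by square-integrable functions; equality in $L^2_\rho$
  is equality almost everywhere.  All sequences of the paper are indexed by the positive integers,
  so the value at index 0 is never used.
\<close>

definition L2 :: "'d measure \<Rightarrow> ('d \<Rightarrow> real) set" where
  "L2 \<rho> = {f \<in> borel_measurable \<rho>. integrable \<rho> (\<lambda>x. (f x)\<^sup>2)}"

definition l2_inner :: "'d measure \<Rightarrow> ('d \<Rightarrow> real) \<Rightarrow> ('d \<Rightarrow> real) \<Rightarrow> real" where
  "l2_inner \<rho> f g = (\<integral>x. f x * g x \<partial>\<rho>)"

definition l2_norm :: "'d measure \<Rightarrow> ('d \<Rightarrow> real) \<Rightarrow> real" where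
  "l2_norm \<rho> f = sqrt (l2_inner \<rho> f f)"

definition l2_dist :: "'d measure \<Rightarrow> ('d \<Rightarrow> real) \<Rightarrow> ('d \<Rightarrow> real) \<Rightarrow> real" where
  "l2_dist \<rho> f g = l2_norm \<rho> (\<lambda>x. f x - g x)"

definition L2_borel :: "'d measure \<Rightarrow> ('d \<Rightarrow> real) measure" where
  "L2_borel \<rho> = sigma (L2 \<rho>)
     {V. V \<subseteq> L2 \<rho> \<and> (\<forall>f\<in>V. \<exists>e>0. \<forall>g\<in>L2 \<rho>. l2_dist \<rho> f g < e \<longrightarrow> g \<in> V)}"

text \<open>The second clause says that \<open>R \<phi>\<close> only depends on the class of \<open>\<phi>\<close> in $L^2_\rho$.\<close>

definition forward_operator ::
    "'d measure \<Rightarrow> (('d \<Rightarrow> real) \<Rightarrow> 'x::banach \<Rightarrow> 'y::{real_inner, polish_space}) \<Rightarrow> bool" where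
  "forward_operator \<rho> R \<longleftrightarrow>
     (\<forall>\<phi>\<in>L2 \<rho>. R \<phi> \<in> borel_measurable borel) \<and>
     (\<forall>\<phi>\<in>L2 \<rho>. \<forall>\<psi>\<in>L2 \<rho>. (AE x in \<rho>. \<phi> x = \<psi> x) \<longrightarrow> R \<phi> = R \<psi>) \<and>
     (\<forall>\<phi>\<in>L2 \<rho>. \<forall>\<psi>\<in>L2 \<rho>. \<forall>c d v.
        R (\<lambda>x. c * \<phi> x + d * \<psi> x) v = c *\<^sub>R R \<phi> v + d *\<^sub>R R \<psi> v)"

definition is_normal_operator ::
    "'w measure \<Rightarrow> 'd measure \<Rightarrow> (('d \<Rightarrow> real) \<Rightarrow> 'x::banach \<Rightarrow> 'y::{real_inner, polish_space})
     \<Rightarrow> ('w \<Rightarrow> 'x) \<Rightarrow> (('d \<Rightarrow> real) \<Rightarrow> ('d \<Rightarrow> real)) \<Rightarrow> bool" where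
  "is_normal_operator \<Omega> \<rho> R u Lop \<longleftrightarrow>
     (\<forall>\<phi>\<in>L2 \<rho>. Lop \<phi> \<in> L2 \<rho>) \<and>
     (\<forall>\<phi>\<in>L2 \<rho>. \<forall>\<psi>\<in>L2 \<rho>.
        integrable \<Omega> (\<lambda>\<omega>. R \<phi> (u \<omega>) \<bullet> R \<psi> (u \<omega>)) \<and>
        l2_inner \<rho> (Lop \<phi>) \<psi> = (\<integral>\<omega>. R \<phi> (u \<omega>) \<bullet> R \<psi> (u \<omega>) \<partial>\<Omega>))"

definition nonneg_selfadjoint :: "'d measure \<Rightarrow> (('d \<Rightarrow> real) \<Rightarrow> ('d \<Rightarrow> real)) \<Rightarrow> bool" where
  "nonneg_selfadjoint \<rho> A \<longleftrightarrow>
     (\<forall>\<phi>\<in>L2 \<rho>. 0 \<le> l2_inner \<rho> (A \<phi>) \<phi>) \<and>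
     (\<forall>\<phi>\<in>L2 \<rho>. \<forall>\<psi>\<in>L2 \<rho>. l2_inner \<rho> (A \<phi>) \<psi> = l2_inner \<rho> \<phi> (A \<psi>))"

definition compact_operator :: "'d measure \<Rightarrow> (('d \<Rightarrow> real) \<Rightarrow> ('d \<Rightarrow> real)) \<Rightarrow> bool" where
  "compact_operator \<rho> A \<longleftrightarrow>
     (\<forall>\<phi>\<in>L2 \<rho>. A \<phi> \<in> L2 \<rho>) \<and>
     (\<forall>\<phi>\<in>L2 \<rho>. \<forall>\<psi>\<in>L2 \<rho>. \<forall>c d.
        AE x in \<rho>. A (\<lambda>z. c * \<phi> z + d * \<psi> z) x = c * A \<phi> x + d * A \<psi> x) \<and>
     (\<forall>f :: nat \<Rightarrow> 'd \<Rightarrow> real.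
        (\<forall>n. f n \<in> L2 \<rho>) \<and> (\<exists>B. \<forall>n. l2_norm \<rho> (f n) \<le> B) \<longrightarrow>
        (\<exists>g\<in>L2 \<rho>. \<exists>s :: nat \<Rightarrow> nat. strict_mono s \<and> (\<lambda>n. l2_dist \<rho> (A (f (s n))) g) \<longlonglongrightarrow> 0))"

text \<open>
  The last clause says that every positive eigenvalue is listed with its full multiplicity: the
  eigenspace of \<open>\<mu>\<close> is spanned by the \<open>\<psi> k\<close> with \<open>lam k = \<mu>\<close>.  For a compact operator
  there are only finitely many such \<open>k\<close>.
\<close>

definition positive_eigensystem ::
    "'d measure \<Rightarrow> (('d \<Rightarrow> real) \<Rightarrow> ('d \<Rightarrow> real)) \<Rightarrow> (nat \<Rightarrow> real) \<Rightarrow> (nat \<Rightarrow> 'd \<Rightarrow> real) \<Rightarrow> bool" where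
  "positive_eigensystem \<rho> A lam \<psi> \<longleftrightarrow>
     (\<forall>k\<ge>1. 0 < lam k \<and> lam (Suc k) \<le> lam k) \<and>
     (\<forall>k\<ge>1. \<psi> k \<in> L2 \<rho> \<and> (AE x in \<rho>. A (\<psi> k) x = lam k * \<psi> k x)) \<and>
     (\<forall>j\<ge>1. \<forall>k\<ge>1. l2_inner \<rho> (\<psi> j) (\<psi> k) = (if j = k then 1 else 0)) \<and>
     (\<forall>\<mu>>0. \<forall>\<phi>\<in>L2 \<rho>. (AE x in \<rho>. A \<phi> x = \<mu> * \<phi> x) \<longrightarrow>
        (\<exists>c. AE x in \<rho>. \<phi> x = (\<Sum>k | 1 \<le> k \<and> lam k = \<mu>. c k * \<psi> k x)))"

definition sobolev_ball ::
    "'d measure \<Rightarrow> (nat \<Rightarrow> real) \<Rightarrow> (nat \<Rightarrow> 'd \<Rightarrow> real) \<Rightarrow> real \<Rightarrow> real \<Rightarrow> ('d \<Rightarrow> real) set" where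
  "sobolev_ball \<rho> lam \<psi> \<beta> L =
     {\<phi> \<in> L2 \<rho>. \<exists>\<theta> :: nat \<Rightarrow> real.
        (\<lambda>n. l2_dist \<rho> (\<lambda>x. \<Sum>k=1..n. \<theta> k * \<psi> k x) \<phi>) \<longlonglongrightarrow> 0 \<and>
        (\<lambda>k. lam k powr (-\<beta>) * (\<theta> k)\<^sup>2) summable_on {1..} \<and>
        (\<Sum>\<^sub>\<infinity>k\<in>{1..}. lam k powr (-\<beta>) * (\<theta> k)\<^sup>2) \<le> L\<^sup>2}"

text \<open>
  \<open>orthonormal_basis I y\<close>: the index set \<open>I\<close> is \<open>{1..n}\<close> if \<open>n\<close> is the
  dimension of the space, and \<open>{1..}\<close> if the dimension is infinite, so that
  \<open>{1..N} \<subseteq> I\<close> expresses that \<open>N\<close> is at most the dimension.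
\<close>

definition orthonormal_basis :: "nat set \<Rightarrow> (nat \<Rightarrow> 'y::{real_inner, polish_space}) \<Rightarrow> bool" where
  "orthonormal_basis I y \<longleftrightarrow>
     ((\<exists>n. I = {1..n}) \<or> I = {1..}) \<and>
     (\<forall>i\<in>I. \<forall>j\<in>I. y i \<bullet> y j = (if i = j then 1 else 0)) \<and>
     closure (span (y ` I)) = UNIV"

text \<open>The noise \<open>\<epsilon> z \<omega>\<close> is the value at \<open>\<omega>\<close> of the random variable $\langle\varepsilon,z\rangle$.\<close>

definition linear_noise ::
    "'w measure \<Rightarrow> ('y::{real_inner, polish_space} \<Rightarrow> 'w \<Rightarrow> real) \<Rightarrow> bool" where
  "linear_noise \<Omega> \<epsilon> \<longleftrightarrow>
     (\<forall>z. \<epsilon> z \<in> borel_measurable \<Omega> \<and> integrable \<Omega> (\<lambda>\<omega>. (\<epsilon> z \<omega>)\<^sup>2)) \<and>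
     (\<forall>z z' c d. AE \<omega> in \<Omega>. \<epsilon> (c *\<^sub>R z + d *\<^sub>R z') \<omega> = c * \<epsilon> z \<omega> + d * \<epsilon> z' \<omega>)"

definition indep_of_input ::
    "'w measure \<Rightarrow> ('w \<Rightarrow> 'x::banach) \<Rightarrow> ('y::{real_inner, polish_space} \<Rightarrow> 'w \<Rightarrow> real) \<Rightarrow> bool" where
  "indep_of_input \<Omega> u \<epsilon> \<longleftrightarrow>
     prob_space.indep_set \<Omega>
       (sets (vimage_algebra (space \<Omega>) u borel))
       (sets (vimage_algebra (space \<Omega>) (\<lambda>\<omega> z. \<epsilon> z \<omega>) (\<Pi>\<^sub>M z\<in>UNIV. borel)))"

definition noise_moments ::
    "'w measure \<Rightarrow> ('y::{real_inner, polish_space} \<Rightarrow> 'w \<Rightarrow> real) \<Rightarrow> real \<Rightarrow> bool" where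
  "noise_moments \<Omega> \<epsilon> \<sigma> \<longleftrightarrow>
     (\<forall>z. (\<integral>\<omega>. \<epsilon> z \<omega> \<partial>\<Omega>) = 0 \<and> (\<integral>\<omega>. (\<epsilon> z \<omega>)\<^sup>2 \<partial>\<Omega>) \<le> \<sigma>\<^sup>2 * (norm z)\<^sup>2)"

text \<open>
  Since \<open>ln\<close>, division and the Bochner integral are total functions, the finite upper bound on
  the integral of \<open>log (p x / p (x + v)) * p x\<close> is spelled out as: \<open>p (x + v)\<close> vanishes
  almost nowhere on \<open>{x. p x > 0}\<close> (otherwise the integral is infinite), the integrand is
  integrable (its negative part always is), and the integral obeys the bound.
\<close>

definition noise_density_bound ::
    "'w measure \<Rightarrow> ('y::{real_inner, polish_space} \<Rightarrow> 'w \<Rightarrow> real) \<Rightarrow> nat set \<Rightarrow> (nat \<Rightarrow> 'y) \<Rightarrow> real \<Rightarrow> bool" where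
  "noise_density_bound \<Omega> \<epsilon> I y \<tau> \<longleftrightarrow>
     (\<forall>N\<ge>1. {1..N} \<subseteq> I \<longrightarrow>
       (\<exists>p :: (nat \<Rightarrow> real) \<Rightarrow> real.
          (\<forall>x. 0 \<le> p x) \<and>
          distributed \<Omega> (\<Pi>\<^sub>M i\<in>{1..N}. lborel) (\<lambda>\<omega>. \<lambda>i\<in>{1..N}. \<epsilon> (y i) \<omega>) (\<lambda>x. ennreal (p x)) \<and>
          (\<forall>v :: nat \<Rightarrow> real.
             let q = (\<lambda>x. p (\<lambda>i\<in>{1..N}. x i + v i)) in
             (AE x in \<Pi>\<^sub>M i\<in>{1..N}. lborel. 0 < p x \<longrightarrow> 0 < q x) \<and>
             integrable (\<Pi>\<^sub>M i\<in>{1..N}. lborel) (\<lambda>x. ln (p x / q x) * p x) \<and>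
             (\<integral>x. ln (p x / q x) * p x \<partial>(\<Pi>\<^sub>M i\<in>{1..N}. lborel)) \<le> \<tau> / 2 * (\<Sum>i=1..N. (v i)\<^sup>2))))"

text \<open>The law of a pair (input, noise) is the joint law of the input and of the family of all $\langle\varepsilon,z\rangle$.\<close>

definition pair_space :: "('x::banach \<times> ('y::{real_inner, polish_space} \<Rightarrow> real)) measure" where
  "pair_space = borel \<Otimes>\<^sub>M (\<Pi>\<^sub>M z\<in>UNIV. borel)"

definition iid_copies ::
    "'w measure \<Rightarrow> ('w \<Rightarrow> 'x::banach) \<Rightarrow> ('y::{real_inner, polish_space} \<Rightarrow> 'w \<Rightarrow> real)
     \<Rightarrow> (nat \<Rightarrow> 'w \<Rightarrow> 'x) \<Rightarrow> (nat \<Rightarrow> 'y \<Rightarrow> 'w \<Rightarrow> real) \<Rightarrow> bool" where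
  "iid_copies \<Omega> u \<epsilon> us \<epsilon>s \<longleftrightarrow>
     prob_space.indep_vars \<Omega> (\<lambda>_. pair_space) (\<lambda>m \<omega>. (us m \<omega>, \<lambda>z. \<epsilon>s m z \<omega>)) {1..} \<and>
     (\<forall>m\<ge>1. distr \<Omega> pair_space (\<lambda>\<omega>. (us m \<omega>, \<lambda>z. \<epsilon>s m z \<omega>)) =
             distr \<Omega> pair_space (\<lambda>\<omega>. (u \<omega>, \<lambda>z. \<epsilon> z \<omega>)))"

text \<open>\<open>observation R us \<epsilon>s \<phi> m z\<close> is the random variable $\langle f^m,z\rangle$ for the kernel \<open>\<phi>\<close>.\<close>

definition observation ::
    "(('d \<Rightarrow> real) \<Rightarrow> 'x::banach \<Rightarrow> 'y::{real_inner, polish_space}) \<Rightarrow> (nat \<Rightarrow> 'w \<Rightarrow> 'x)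
     \<Rightarrow> (nat \<Rightarrow> 'y \<Rightarrow> 'w \<Rightarrow> real) \<Rightarrow> ('d \<Rightarrow> real) \<Rightarrow> nat \<Rightarrow> 'y \<Rightarrow> 'w \<Rightarrow> real" where
  "observation R us \<epsilon>s \<phi> m z \<omega> = R \<phi> (us m \<omega>) \<bullet> z + \<epsilon>s m z \<omega>"

definition data_space :: "nat set \<Rightarrow> nat \<Rightarrow> (nat \<Rightarrow> 'x::banach \<times> (nat \<Rightarrow> real)) measure" where
  "data_space I M = (\<Pi>\<^sub>M m\<in>{1..M}. borel \<Otimes>\<^sub>M (\<Pi>\<^sub>M i\<in>I. borel))"

definition data ::
    "(('d \<Rightarrow> real) \<Rightarrow> 'x::banach \<Rightarrow> 'y::{real_inner, polish_space}) \<Rightarrow> (nat \<Rightarrow> 'w \<Rightarrow> 'x)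
     \<Rightarrow> (nat \<Rightarrow> 'y \<Rightarrow> 'w \<Rightarrow> real) \<Rightarrow> nat set \<Rightarrow> (nat \<Rightarrow> 'y) \<Rightarrow> nat \<Rightarrow> ('d \<Rightarrow> real)
     \<Rightarrow> 'w \<Rightarrow> (nat \<Rightarrow> 'x \<times> (nat \<Rightarrow> real))" where
  "data R us \<epsilon>s I y M \<phi> \<omega> =
     (\<lambda>m\<in>{1..M}. (us m \<omega>, \<lambda>i\<in>I. observation R us \<epsilon>s \<phi> m (y i) \<omega>))"

text \<open>
  An estimator may depend on everything except the kernel: the infimum in \<open>minimax_risk\<close> is
  taken with the model fixed, before the supremum over the kernels.
\<close>

definition estimators ::
    "'d measure \<Rightarrow> nat set \<Rightarrow> nat \<Rightarrow> ((nat \<Rightarrow> 'x::banach \<times> (nat \<Rightarrow> real)) \<Rightarrow> ('d \<Rightarrow> real)) set" where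
  "estimators \<rho> I M = measurable (data_space I M) (L2_borel \<rho>)"

definition minimax_risk ::
    "'w measure \<Rightarrow> 'd measure \<Rightarrow> (('d \<Rightarrow> real) \<Rightarrow> 'x::banach \<Rightarrow> 'y::{real_inner, polish_space})
     \<Rightarrow> (nat \<Rightarrow> 'w \<Rightarrow> 'x) \<Rightarrow> (nat \<Rightarrow> 'y \<Rightarrow> 'w \<Rightarrow> real) \<Rightarrow> nat set \<Rightarrow> (nat \<Rightarrow> 'y)
     \<Rightarrow> ('d \<Rightarrow> real) set \<Rightarrow> real \<Rightarrow> nat \<Rightarrow> ennreal" where
  "minimax_risk \<Omega> \<rho> R us \<epsilon>s I y H s M =
     (INF T\<in>estimators \<rho> I M. SUP \<phi>\<in>H.
        \<integral>\<^sup>+ \<omega>. ennreal (real M powr s * (l2_dist \<rho> (T (data R us \<epsilon>s I y M \<phi> \<omega>)) \<phi>)\<^sup>2) \<partial>\<Omega>)"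

end

theory Submission
  imports Defs
begin

text \<open>
  The bound is Assouad's: on a hypercube of kernels $\sum_{k\in K}\pm c_k\psi_k$ inside the Sobolev
  ball an estimator has to guess every sign, and a sign costs $c_k^2$ if the two laws of the data
  that differ in it overlap.  Given the input, the data are the noise translated by the signal, so
  by (B2) and Bessel's inequality in $\mathbb Y$ the relative entropy per sample is at most
  $\frac\tau2\langle\mathcal L\zeta,\zeta\rangle$ for kernels with difference $\zeta$, which is
  $2\tau\lambda_kc_k^2$ for a flip of the sign of $\psi_k$; hence $4M\tau\lambda_kc_k^2\le1$ makes
  the total variation distance at most $\frac12$.  Pinsker's inequality is used in the linearised form
  $P(A)-Q(A)\le\mathrm{KL}/s+s/8$, a consequence of Hoeffding's lemma that needs no root of an
  integrated quantity.  Since (B2) only speaks about finitely many coordinates of the noise, the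
  total variation bound is obtained on cylinder sets first.  For polynomial decay $K=\{n+1,\dots,2n\}$
  with $n$ of the order of a power of $M$; for exponential decay a single $k$ suffices.
\<close>

section \<open>Relative entropy and total variation for product measures\<close>

text \<open>The density in (B2) may vanish, so one law of the data need not have a density with
  respect to the other. The likelihood ratio therefore enters only through the one-sided bound
  \<open>\<integral> H * ratio dP \<le> \<integral> H dP'\<close>, which passes to products of
  samples and is enough for the entropy argument. After Bessel's inequality the bound on cylinder
  sets no longer depends on the number of noise coordinates, and this is why it survives the passage
  to all events. Constants: for \<open>s = 2\<close> and total relative entropy 1/2 the linearised
  Pinsker bound reads 1/4 + 1/4. The probabilities of the wrong sign at two neighbouring vertices
  then add up to at least 1/2, on average 1/4 each. With \<open>c k\<close> squared equal to
  \<open>L^2 * lam k powr \<beta> / card K\<close> the Sobolev budget is used up exactly and the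
  overlap condition becomes
  \<open>4 * M * \<tau> * L^2 * lam k powr (\<beta> + 1) \<le> card K\<close>. Solving it leaves a
  factor \<open>4 powr (-\<gamma>)\<close> with \<open>\<gamma> < 1\<close>, hence above 1/4: the
  two quarters are the 1/16 of both constants, and the strict inequality pays for rounding in the
  polynomial case.\<close>

lemma (in prob_space) bernoulli_mgf_le:
  fixes s :: real
  assumes "A \<in> events" "s > 0"
  shows "(\<integral>\<^sup>+x. ennreal (exp (s * (indicator A x - prob A))) \<partial>M) \<le> ennreal (exp (s\<^sup>2 / 8))"
proof -
  interpret interval_bounded_random_variable M "\<lambda>x. indicator A x - prob A" "- prob A" "1 - prob A"
    by unfold_locales (use assms in \<open>auto simp: indicator_def\<close>)
  have "expectation (\<lambda>x. indicator A x - prob A) = 0"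
    using assms by (subst Bochner_Integration.integral_diff) (auto simp: prob_space emeasure_eq_measure)
  from Hoeffdings_lemma_nn_integral_0[OF assms(2) this] show ?thesis by simp
qed

text \<open>Domination of \<open>\<rho>\<close> times \<open>K\<close> by \<open>K'\<close> is
  inherited by products: the integrands are nonnegative, so Tonelli allows \<open>K\<close> to be
  exchanged for \<open>K'\<close> one coordinate at a time. An inequality is the right hypothesis
  because \<open>K'\<close> may charge sets that are null for \<open>K\<close>.\<close>

lemma nn_integral_PiM_density_le:
  fixes K K' :: "'a measure" and \<rho> :: "'a \<Rightarrow> ennreal"
  assumes K: "prob_space K" and K': "prob_space K'" and sets: "sets K' = sets K"
    and \<rho>[measurable]: "\<rho> \<in> borel_measurable K"
    and le: "\<And>H. H \<in> borel_measurable K \<Longrightarrow> (\<integral>\<^sup>+x. H x * \<rho> x \<partial>K) \<le> (\<integral>\<^sup>+x. H x \<partial>K')"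
    and "finite J"
  shows "H \<in> borel_measurable (\<Pi>\<^sub>M j\<in>J. K) \<Longrightarrow>
    (\<integral>\<^sup>+x. H x * (\<Prod>j\<in>J. \<rho> (x j)) \<partial>(\<Pi>\<^sub>M j\<in>J. K)) \<le> (\<integral>\<^sup>+x. H x \<partial>(\<Pi>\<^sub>M j\<in>J. K'))"
  using \<open>finite J\<close>
proof (induction J arbitrary: H)
  case empty
  then show ?case by (simp add: PiM_empty)
next
  case (insert j J)
  interpret K: prob_space K by fact
  interpret K': prob_space K' by fact
  interpret P: product_sigma_finite "\<lambda>_. K" by unfold_locales
  interpret PJ: prob_space "\<Pi>\<^sub>M j\<in>J. K" by (intro prob_space_PiM K)
  interpret P': product_sigma_finite "\<lambda>_. K'" by unfold_locales
  note [measurable] = insert.prems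
  note [measurable_cong] = sets
  have sets': "sets (\<Pi>\<^sub>M j\<in>J. K') = sets (\<Pi>\<^sub>M j\<in>J. K)" for J :: "'b set"
    by (intro sets_PiM_cong sets refl)
  note [measurable_cong] = sets'
  have H'[measurable]: "H \<in> borel_measurable (\<Pi>\<^sub>M j\<in>insert j J. K')"
    using insert.prems by (subst measurable_cong_sets[OF sets' refl])
  let ?U = "\<lambda>y. (\<integral>\<^sup>+x. H (x(j := y)) * (\<Prod>i\<in>J. \<rho> (x i)) \<partial>(\<Pi>\<^sub>M j\<in>J. K))"
  have U[measurable]: "?U \<in> borel_measurable K"
    by (rule PJ.borel_measurable_nn_integral) measurable
  have "(\<integral>\<^sup>+x. H x * (\<Prod>i\<in>insert j J. \<rho> (x i)) \<partial>(\<Pi>\<^sub>M j\<in>insert j J. K))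
    = (\<integral>\<^sup>+y. (\<integral>\<^sup>+x. H (x(j := y)) * (\<Prod>i\<in>insert j J. \<rho> ((x(j:=y)) i)) \<partial>(\<Pi>\<^sub>M j\<in>J. K)) \<partial>K)"
    using insert.hyps by (intro P.product_nn_integral_insert_rev) measurable
  also have "\<dots> = (\<integral>\<^sup>+y. (\<integral>\<^sup>+x. \<rho> y * (H (x(j := y)) * (\<Prod>i\<in>J. \<rho> (x i))) \<partial>(\<Pi>\<^sub>M j\<in>J. K)) \<partial>K)"
    using insert.hyps by (intro nn_integral_cong) (auto simp: mult_ac intro!: prod.cong arg_cong2[where f="(*)"])
  also have "\<dots> = (\<integral>\<^sup>+y. ?U y * \<rho> y \<partial>K)"
    by (intro nn_integral_cong, subst nn_integral_cmult) (auto simp: mult_ac)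
  also have "\<dots> \<le> (\<integral>\<^sup>+y. ?U y \<partial>K')"
    by (rule le) measurable
  also have "\<dots> \<le> (\<integral>\<^sup>+y. (\<integral>\<^sup>+x. H (x(j := y)) \<partial>(\<Pi>\<^sub>M j\<in>J. K')) \<partial>K')"
  proof (rule nn_integral_mono)
    fix y assume "y \<in> space K'"
    then have [measurable]: "y \<in> space K" by (simp add: sets_eq_imp_space_eq[OF sets])
    show "?U y \<le> (\<integral>\<^sup>+x. H (x(j := y)) \<partial>(\<Pi>\<^sub>M j\<in>J. K'))"
      by (rule insert.IH) measurable
  qed
  also have "\<dots> = (\<integral>\<^sup>+x. H x \<partial>(\<Pi>\<^sub>M j\<in>insert j J. K'))"
    using insert.hyps by (intro P'.product_nn_integral_insert_rev[symmetric]) measurable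
  finally show ?case .
qed

text \<open>This is the Donsker-Varadhan inequality for a multiple of the centred indicator of
  \<open>A\<close>, whose exponential moment is bounded by Hoeffding's lemma; the entropies of the
  \<open>card J\<close> factors add up. Optimising over \<open>s\<close> would give Pinsker's
  \<open>sqrt (KL / 2)\<close>.\<close>

lemma prob_diff_PiM_le:
  fixes K K' :: "'a measure" and \<rho> :: "'a \<Rightarrow> real" and \<kappa> s :: real
  assumes K: "prob_space K" and K': "prob_space K'" and sets: "sets K' = sets K"
    and \<rho>[measurable]: "\<rho> \<in> borel_measurable K" and pos: "AE x in K. \<rho> x > 0"
    and le: "\<And>H. H \<in> borel_measurable K \<Longrightarrow> (\<integral>\<^sup>+x. H x * ennreal (\<rho> x) \<partial>K) \<le> (\<integral>\<^sup>+x. H x \<partial>K')"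
    and int: "integrable K (\<lambda>x. ln (\<rho> x))" and \<kappa>: "(\<integral>x. - ln (\<rho> x) \<partial>K) \<le> \<kappa>"
    and J: "finite J" and A: "A \<in> sets (\<Pi>\<^sub>M j\<in>J. K)" and s: "s > 0"
  shows "measure (\<Pi>\<^sub>M j\<in>J. K) A - measure (\<Pi>\<^sub>M j\<in>J. K') A \<le> card J * \<kappa> / s + s / 8"
proof -
  let ?P = "\<Pi>\<^sub>M j\<in>J. K" and ?P' = "\<Pi>\<^sub>M j\<in>J. K'"
  have sets': "sets ?P' = sets ?P" by (intro sets_PiM_cong sets refl)
  interpret P: prob_space ?P by (intro prob_space_PiM K)
  interpret P': prob_space ?P' by (intro prob_space_PiM K')
  have A'[measurable]: "A \<in> sets ?P'" using A by (simp add: sets')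
  note [measurable] = A
  \<comment> \<open>Subtracting \<open>s^2 / 8\<close> normalises the exponential moment of
    \<open>g\<close> under \<open>?P'\<close> to at most 1, so that no logarithm of an integral has
    to be taken.\<close>
  define g where "g x = s * (indicator A x - measure ?P' A) - s\<^sup>2 / 8" for x
  have gm[measurable]: "g \<in> borel_measurable ?P" unfolding g_def by measurable
  have intg: "integrable ?P g" unfolding g_def
    by (intro Bochner_Integration.integrable_diff integrable_mult_right integrable_real_indicator)
       (auto simp: A P.emeasure_eq_measure)
  have Eg: "(\<integral>x. g x \<partial>?P) = s * (measure ?P A - measure ?P' A) - s\<^sup>2 / 8"
    unfolding g_def
    by (subst Bochner_Integration.integral_diff)
       (auto simp: A P.emeasure_eq_measure P.prob_space Bochner_Integration.integral_diff)
  have comp: "distr ?P K (\<lambda>x. x j) = K" if "j \<in> J" for j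
    using that K by (intro distr_PiM_component) auto
  have intl: "integrable ?P (\<lambda>x. ln (\<rho> (x j)))" if "j \<in> J" for j
    using int that by (subst (asm) comp[OF that, symmetric], subst (asm) integrable_distr_eq) auto
  have El: "(\<integral>x. ln (\<rho> (x j)) \<partial>?P) = (\<integral>x. ln (\<rho> x) \<partial>K)" if "j \<in> J" for j
    using that by (subst (2) comp[OF that, symmetric], subst integral_distr) auto
  have "AE x in ?P. \<forall>j\<in>J. 0 < \<rho> (x j)"
    using J K pos by (intro AE_finite_allI AE_PiM_component) auto
  then have ae: "AE x in ?P. 1 + g x + (\<Sum>j\<in>J. ln (\<rho> (x j))) \<le> exp (g x) * (\<Prod>j\<in>J. \<rho> (x j))"
  proof eventually_elim
    case (elim x)
    \<comment> \<open>Integrating this tangent-line bound replaces Jensen's inequality: the right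
      side has integral at most 1, so the mean of \<open>g\<close> is at most minus the mean of the
      log-likelihood ratios.\<close>
    have "1 + (g x + (\<Sum>j\<in>J. ln (\<rho> (x j)))) \<le> exp (g x + (\<Sum>j\<in>J. ln (\<rho> (x j))))"
      by (rule exp_ge_add_one_self)
    also have "\<dots> = exp (g x) * (\<Prod>j\<in>J. \<rho> (x j))"
      using elim J by (simp add: exp_add exp_sum)
    finally show ?case by simp
  qed
  have pos': "AE x in ?P. 0 \<le> exp (g x) * (\<Prod>j\<in>J. \<rho> (x j))"
    using \<open>AE x in ?P. \<forall>j\<in>J. 0 < \<rho> (x j)\<close> 
    by eventually_elim (auto intro!: mult_nonneg_nonneg prod_nonneg simp: less_imp_le)
  have "(\<integral>\<^sup>+x. ennreal (exp (g x) * (\<Prod>j\<in>J. \<rho> (x j))) \<partial>?P)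
      = (\<integral>\<^sup>+x. ennreal (exp (g x)) * (\<Prod>j\<in>J. ennreal (\<rho> (x j))) \<partial>?P)"
    using \<open>AE x in ?P. \<forall>j\<in>J. 0 < \<rho> (x j)\<close>
    by (intro nn_integral_cong_AE, eventually_elim)
       (auto simp: ennreal_mult prod_ennreal less_imp_le prod_nonneg)
  also have "\<dots> \<le> (\<integral>\<^sup>+x. ennreal (exp (g x)) \<partial>?P')"
  proof (rule nn_integral_PiM_density_le[OF K K' sets _ le J])
    show "(\<lambda>x. ennreal (\<rho> x)) \<in> borel_measurable K" by measurable
    show "(\<lambda>x. ennreal (exp (g x))) \<in> borel_measurable ?P"
      by (intro measurable_compose[OF gm]) measurable
  qed
  also have "\<dots> = (\<integral>\<^sup>+x. ennreal (exp (s * (indicator A x - measure ?P' A))) * ennreal (exp (- (s\<^sup>2 / 8))) \<partial>?P')"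
  proof (rule nn_integral_cong)
    fix x
    have "exp (g x) = exp (s * (indicator A x - measure ?P' A)) * exp (- (s\<^sup>2 / 8))"
      unfolding g_def exp_add[symmetric] by simp
    then show "ennreal (exp (g x))
        = ennreal (exp (s * (indicator A x - measure ?P' A))) * ennreal (exp (- (s\<^sup>2 / 8)))"
      by (simp add: ennreal_mult)
  qed
  also have "\<dots> = (\<integral>\<^sup>+x. ennreal (exp (s * (indicator A x - measure ?P' A))) \<partial>?P') * ennreal (exp (- (s\<^sup>2 / 8)))"
    by (intro nn_integral_multc) measurable
  also have "\<dots> \<le> ennreal (exp (s\<^sup>2 / 8)) * ennreal (exp (- (s\<^sup>2 / 8)))"
    by (intro mult_right_mono P'.bernoulli_mgf_le A' s) simp
  also have "\<dots> = ennreal (exp (s\<^sup>2 / 8) * exp (- (s\<^sup>2 / 8)))" by (simp add: ennreal_mult)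
  also have "\<dots> = 1" unfolding exp_add[symmetric] by simp
  finally have le1: "(\<integral>\<^sup>+x. ennreal (exp (g x) * (\<Prod>j\<in>J. \<rho> (x j))) \<partial>?P) \<le> 1" .
  have intE: "integrable ?P (\<lambda>x. exp (g x) * (\<Prod>j\<in>J. \<rho> (x j)))"
    using le1 pos' by (intro integrableI_nonneg) (auto intro: le_less_trans)
  have "(\<integral>x. exp (g x) * (\<Prod>j\<in>J. \<rho> (x j)) \<partial>?P) \<le> 1"
    using le1 pos' by (subst (asm) nn_integral_eq_integral[OF intE]) (auto simp flip: ennreal_1)
  moreover have "(\<integral>x. 1 + g x + (\<Sum>j\<in>J. ln (\<rho> (x j))) \<partial>?P) \<le> (\<integral>x. exp (g x) * (\<Prod>j\<in>J. \<rho> (x j)) \<partial>?P)"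
    using ae intg intl by (intro integral_mono_AE intE) auto
  moreover have "(\<integral>x. 1 + g x + (\<Sum>j\<in>J. ln (\<rho> (x j))) \<partial>?P) = 1 + (\<integral>x. g x \<partial>?P) + card J * (\<integral>x. ln (\<rho> x) \<partial>K)"
    using intg intl El by (simp add: Bochner_Integration.integral_add P.prob_space Bochner_Integration.integral_sum)
  ultimately have "(\<integral>x. g x \<partial>?P) \<le> card J * (\<integral>x. - ln (\<rho> x) \<partial>K)" by simp
  also have "\<dots> \<le> card J * \<kappa>" using \<kappa> by (intro mult_left_mono) auto
  finally have "s * (measure ?P A - measure ?P' A) \<le> card J * \<kappa> + s\<^sup>2 / 8" unfolding Eg by simp
  then show ?thesis using s by (simp add: field_simps power2_eq_square)
qed

section \<open>Translated noise\<close>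

text \<open>The restriction to \<open>J\<close> keeps the result in the space of the product measure
  and matches literally the translate that occurs in (B2).\<close>

definition shift_by :: "'i set \<Rightarrow> ('i \<Rightarrow> real) \<Rightarrow> ('i \<Rightarrow> real) \<Rightarrow> 'i \<Rightarrow> real" where
  "shift_by J a z = (\<lambda>i\<in>J. z i + a i)"

lemma measurable_shift_by[measurable (raw)]:
  assumes f: "f \<in> measurable N (\<Pi>\<^sub>M i\<in>J. lborel)" and a: "\<And>i. i \<in> J \<Longrightarrow> (\<lambda>x. a x i) \<in> borel_measurable N"
  shows "(\<lambda>x. shift_by J (a x) (f x)) \<in> measurable N (\<Pi>\<^sub>M i\<in>J. lborel)"
  unfolding shift_by_def
proof (rule measurable_restrict)
  fix i assume i: "i \<in> J"
  have "(\<lambda>x. f x i) \<in> borel_measurable N"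
    using measurable_compose[OF f measurable_component_singleton[OF i]] by simp
  then show "(\<lambda>x. f x i + a x i) \<in> measurable N lborel" using a[OF i] by simp
qed

lemma shift_by_shift_by: "shift_by J a (shift_by J b z) = shift_by J (\<lambda>i. a i + b i) z"
  by (auto simp: shift_by_def fun_eq_iff add_ac)

lemma shift_by_0: "z \<in> extensional J \<Longrightarrow> shift_by J (\<lambda>i. 0) z = z"
  by (auto simp: shift_by_def fun_eq_iff extensional_def)

text \<open>It suffices to compare the two measures on boxes, whose preimages are again boxes; there
  the claim is translation invariance in each coordinate.\<close>

lemma distr_PiM_lborel_shift_by:
  assumes J: "finite J"
  shows "distr (\<Pi>\<^sub>M i\<in>J. lborel) (\<Pi>\<^sub>M i\<in>J. lborel) (shift_by J a) = (\<Pi>\<^sub>M i\<in>J. lborel)"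
proof -
  interpret product_sigma_finite "\<lambda>_. lborel :: real measure" by unfold_locales
  show ?thesis
  proof (rule PiM_eqI[OF J])
    fix A :: "'a \<Rightarrow> real set" assume A: "\<And>i. i \<in> J \<Longrightarrow> A i \<in> sets lborel"
    have A'[simp]: "(\<lambda>x. a i + x) -` A i \<in> sets borel" if "i \<in> J" for i
      using measurable_sets[of "(+) (a i)" borel borel "A i"] A[OF that] by simp
    have "emeasure (distr (\<Pi>\<^sub>M i\<in>J. lborel) (\<Pi>\<^sub>M i\<in>J. lborel) (shift_by J a)) (Pi\<^sub>E J A)
      = emeasure (\<Pi>\<^sub>M i\<in>J. lborel) (shift_by J a -` Pi\<^sub>E J A \<inter> space (\<Pi>\<^sub>M i\<in>J. lborel))"
      by (intro emeasure_distr sets_PiM_I_finite J A) measurable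
    also have "shift_by J a -` Pi\<^sub>E J A \<inter> space (\<Pi>\<^sub>M i\<in>J. lborel) = Pi\<^sub>E J (\<lambda>i. (\<lambda>x. a i + x) -` A i)"
      by (auto simp: space_PiM shift_by_def PiE_iff add.commute)
    also have "emeasure (\<Pi>\<^sub>M i\<in>J. lborel) \<dots> = (\<Prod>i\<in>J. emeasure lborel ((\<lambda>x. a i + x) -` A i))"
      by (intro emeasure_PiM J) simp
    also have "\<dots> = (\<Prod>i\<in>J. emeasure (distr lborel borel ((+) (a i))) (A i))"
      using A by (intro prod.cong refl) (subst emeasure_distr, auto)
    also have "\<dots> = (\<Prod>i\<in>J. emeasure lborel (A i))" by (simp add: lborel_distr_plus)
    finally show "emeasure (distr (\<Pi>\<^sub>M i\<in>J. lborel) (\<Pi>\<^sub>M i\<in>J. lborel) (shift_by J a)) (Pi\<^sub>E J A)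
      = (\<Prod>i\<in>J. emeasure lborel (A i))" .
  qed simp
qed

lemma nn_integral_PiM_lborel_shift_by:
  assumes J: "finite J" and [measurable]: "f \<in> borel_measurable (\<Pi>\<^sub>M i\<in>J. lborel)"
  shows "(\<integral>\<^sup>+z. f (shift_by J a z) \<partial>(\<Pi>\<^sub>M i\<in>J. lborel)) = (\<integral>\<^sup>+z. f z \<partial>(\<Pi>\<^sub>M i\<in>J. lborel))"
  by (subst (2) distr_PiM_lborel_shift_by[OF J, of a, symmetric], subst nn_integral_distr) measurable

section \<open>The law of one sample and its likelihood ratio\<close>

definition signal_plus_noise ::
    "'x measure \<Rightarrow> nat set \<Rightarrow> ((nat \<Rightarrow> real) \<Rightarrow> real) \<Rightarrow> ('x \<Rightarrow> nat \<Rightarrow> real) \<Rightarrow> ('x \<times> (nat \<Rightarrow> real)) measure" where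
  "signal_plus_noise \<mu> J p w =
     distr (\<mu> \<Otimes>\<^sub>M density (\<Pi>\<^sub>M i\<in>J. lborel) p) (\<mu> \<Otimes>\<^sub>M (\<Pi>\<^sub>M i\<in>J. lborel)) (\<lambda>(x, e). (x, shift_by J (w x) e))"

locale noise_density = M: prob_space \<mu> + N: prob_space "density (\<Pi>\<^sub>M i\<in>J. lborel) (\<lambda>z. ennreal (p z))"
  for \<mu> :: "'x measure" and J :: "nat set" and p :: "(nat \<Rightarrow> real) \<Rightarrow> real" +
  assumes finJ: "finite J"
    and pm[measurable]: "p \<in> borel_measurable (\<Pi>\<^sub>M i\<in>J. lborel)"
    and p0: "\<And>z. 0 \<le> p z"
begin

abbreviation "\<Lambda> \<equiv> \<Pi>\<^sub>M i\<in>J. (lborel :: real measure)"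
abbreviation "\<nu> \<equiv> density \<Lambda> (\<lambda>z. ennreal (p z))"

sublocale pair_prob_space \<mu> \<nu> ..

lemma measurable_signal_plus_noise:
  assumes [measurable]: "\<And>i. (\<lambda>x. w x i) \<in> borel_measurable \<mu>"
  shows "(\<lambda>(x, e). (x, shift_by J (w x) e)) \<in> measurable (\<mu> \<Otimes>\<^sub>M \<nu>) (\<mu> \<Otimes>\<^sub>M \<Lambda>)"
  by measurable

lemma prob_space_signal_plus_noise:
  assumes "\<And>i. (\<lambda>x. w x i) \<in> borel_measurable \<mu>"
  shows "prob_space (signal_plus_noise \<mu> J p w)"
  unfolding signal_plus_noise_def
  by (intro prob_space_distr measurable_signal_plus_noise assms)

lemma sets_signal_plus_noise[simp, measurable_cong]: "sets (signal_plus_noise \<mu> J p w) = sets (\<mu> \<Otimes>\<^sub>M \<Lambda>)"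
  by (simp add: signal_plus_noise_def)

lemma nn_integral_signal_plus_noise:
  assumes [measurable]: "\<And>i. (\<lambda>x. w x i) \<in> borel_measurable \<mu>" "H \<in> borel_measurable (\<mu> \<Otimes>\<^sub>M \<Lambda>)"
  shows "(\<integral>\<^sup>+z. H z \<partial>signal_plus_noise \<mu> J p w)
    = (\<integral>\<^sup>+x. \<integral>\<^sup>+e. ennreal (p e) * H (x, shift_by J (w x) e) \<partial>\<Lambda> \<partial>\<mu>)"
proof -
  have "(\<integral>\<^sup>+z. H z \<partial>signal_plus_noise \<mu> J p w)
      = (\<integral>\<^sup>+z. H (fst z, shift_by J (w (fst z)) (snd z)) \<partial>(\<mu> \<Otimes>\<^sub>M \<nu>))"
    unfolding signal_plus_noise_def
    by (subst nn_integral_distr) (auto intro!: nn_integral_cong measurable_signal_plus_noise simp: case_prod_beta)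
  also have "\<dots> = (\<integral>\<^sup>+x. \<integral>\<^sup>+e. H (x, shift_by J (w x) e) \<partial>\<nu> \<partial>\<mu>)"
    by (subst N.nn_integral_fst[symmetric]) auto
  also have "\<dots> = (\<integral>\<^sup>+x. \<integral>\<^sup>+e. ennreal (p e) * H (x, shift_by J (w x) e) \<partial>\<Lambda> \<partial>\<mu>)"
    by (intro nn_integral_cong nn_integral_density) auto
  finally show ?thesis .
qed

text \<open>The ratio of the law with signal \<open>w'\<close> to the law with signal
  \<open>w\<close>, in this order. Division by 0 gives 0, so it vanishes where the law with signal
  \<open>w\<close> has no density.\<close>

definition lik_ratio :: "('x \<Rightarrow> nat \<Rightarrow> real) \<Rightarrow> ('x \<Rightarrow> nat \<Rightarrow> real) \<Rightarrow> 'x \<times> (nat \<Rightarrow> real) \<Rightarrow> real" where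
  "lik_ratio w w' = (\<lambda>(x, z). p (shift_by J (\<lambda>i. - w' x i) z) / p (shift_by J (\<lambda>i. - w x i) z))"

lemma lik_ratio_shift_by:
  "e \<in> space \<Lambda> \<Longrightarrow> lik_ratio w w' (x, shift_by J (w x) e) = p (shift_by J (\<lambda>i. w x i - w' x i) e) / p e"
  by (simp add: lik_ratio_def shift_by_shift_by shift_by_0 space_PiM PiE_def)

text \<open>Equality fails exactly where \<open>p e = 0 < p z\<close>: this is the mass of the
  second law that the ratio does not see.\<close>

lemma density_mult_ratio_le: "ennreal (p e) * ennreal (p z / p e) \<le> ennreal (p z)"
proof (cases "p e = 0")
  case False
  have "ennreal (p e) * ennreal (p z / p e) = ennreal (p e * (p z / p e))"
    by (rule ennreal_mult[symmetric]) (simp_all add: p0)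
  also have "\<dots> = ennreal (p z)" using False by simp
  finally show ?thesis by simp
qed simp

lemma measurable_lik_ratio:
  assumes [measurable]: "\<And>i. (\<lambda>x. w x i) \<in> borel_measurable \<mu>" "\<And>i. (\<lambda>x. w' x i) \<in> borel_measurable \<mu>"
  shows "lik_ratio w w' \<in> borel_measurable (\<mu> \<Otimes>\<^sub>M \<Lambda>)"
  unfolding lik_ratio_def by measurable

text \<open>This provides the domination hypothesis of \<open>prob_diff_PiM_le\<close>. For fixed
  input the denominator cancels against the noise density, and translation invariance of Lebesgue
  measure turns the rest into the integral for the signal \<open>w'\<close>.\<close>

lemma nn_integral_lik_ratio_le:
  assumes w[measurable]: "\<And>i. (\<lambda>x. w x i) \<in> borel_measurable \<mu>" "\<And>i. (\<lambda>x. w' x i) \<in> borel_measurable \<mu>"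
    and H[measurable]: "H \<in> borel_measurable (\<mu> \<Otimes>\<^sub>M \<Lambda>)"
  shows "(\<integral>\<^sup>+z. H z * ennreal (lik_ratio w w' z) \<partial>signal_plus_noise \<mu> J p w)
    \<le> (\<integral>\<^sup>+z. H z \<partial>signal_plus_noise \<mu> J p w')"
proof -
  note [measurable] = measurable_lik_ratio[OF w]
  have "(\<integral>\<^sup>+z. H z * ennreal (lik_ratio w w' z) \<partial>signal_plus_noise \<mu> J p w)
      = (\<integral>\<^sup>+x. \<integral>\<^sup>+e. ennreal (p e) * (H (x, shift_by J (w x) e) * ennreal (lik_ratio w w' (x, shift_by J (w x) e))) \<partial>\<Lambda> \<partial>\<mu>)"
    by (rule nn_integral_signal_plus_noise) measurable
  also have "\<dots> \<le> (\<integral>\<^sup>+x. \<integral>\<^sup>+e. ennreal (p e) * H (x, shift_by J (w' x) e) \<partial>\<Lambda> \<partial>\<mu>)"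
  proof (rule nn_integral_mono)
    fix x assume x[measurable]: "x \<in> space \<mu>"
    \<comment> \<open>The integrand after the cancellation. Translating its argument by
      \<open>w' x - w x\<close> restores \<open>p e\<close> and moves the observation from the
      signal \<open>w\<close> to the signal \<open>w'\<close>.\<close>
    define F where "F e = ennreal (p (shift_by J (\<lambda>i. w x i - w' x i) e)) * H (x, shift_by J (w x) e)" for e
    have Fm: "F \<in> borel_measurable \<Lambda>" unfolding F_def by measurable
    have "(\<integral>\<^sup>+e. ennreal (p e) * (H (x, shift_by J (w x) e) * ennreal (lik_ratio w w' (x, shift_by J (w x) e))) \<partial>\<Lambda>)
        \<le> (\<integral>\<^sup>+e. F e \<partial>\<Lambda>)"
    proof (rule nn_integral_mono)
      fix e assume e: "e \<in> space \<Lambda>"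
      have "ennreal (p e) * (H (x, shift_by J (w x) e) * ennreal (lik_ratio w w' (x, shift_by J (w x) e)))
          = (ennreal (p e) * ennreal (lik_ratio w w' (x, shift_by J (w x) e))) * H (x, shift_by J (w x) e)"
        by (simp only: mult_ac)
      also have "\<dots> \<le> F e"
        unfolding F_def lik_ratio_shift_by[OF e] by (intro mult_right_mono density_mult_ratio_le) simp
      finally show "ennreal (p e) * (H (x, shift_by J (w x) e) * ennreal (lik_ratio w w' (x, shift_by J (w x) e))) \<le> F e" .
    qed
    also have "\<dots> = (\<integral>\<^sup>+e. F (shift_by J (\<lambda>i. w' x i - w x i) e) \<partial>\<Lambda>)"
      by (rule nn_integral_PiM_lborel_shift_by[OF finJ Fm, symmetric])
    also have "\<dots> = (\<integral>\<^sup>+e. ennreal (p e) * H (x, shift_by J (w' x) e) \<partial>\<Lambda>)"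
      by (intro nn_integral_cong) (simp add: F_def shift_by_shift_by shift_by_0 space_PiM PiE_def)
    finally show "(\<integral>\<^sup>+e. ennreal (p e) * (H (x, shift_by J (w x) e) * ennreal (lik_ratio w w' (x, shift_by J (w x) e))) \<partial>\<Lambda>)
      \<le> (\<integral>\<^sup>+e. ennreal (p e) * H (x, shift_by J (w' x) e) \<partial>\<Lambda>)" .
  qed
  also have "\<dots> = (\<integral>\<^sup>+z. H z \<partial>signal_plus_noise \<mu> J p w')"
    by (rule nn_integral_signal_plus_noise[symmetric]) measurable
  finally show ?thesis .
qed

end

section \<open>Relative entropy between two laws of one sample\<close>

locale kl_noise_density = noise_density +
  fixes \<tau> :: real
  assumes \<tau>: "\<tau> \<ge> 0"
    and abs_cont: "\<And>v. AE z in \<Lambda>. 0 < p z \<longrightarrow> 0 < p (shift_by J v z)"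
    and kl_int: "\<And>v. integrable \<Lambda> (\<lambda>z. ln (p z / p (shift_by J v z)) * p z)"
    and kl_le: "\<And>v. (\<integral>z. ln (p z / p (shift_by J v z)) * p z \<partial>\<Lambda>) \<le> \<tau> / 2 * (\<Sum>i\<in>J. (v i)\<^sup>2)"
begin

lemma AE_density_ratio_pos: "AE e in \<nu>. 0 < p (shift_by J v e) / p e"
  using abs_cont[of v] by (subst AE_density) (auto elim!: eventually_mono)

lemma
  shows integrable_ln_density_ratio: "integrable \<nu> (\<lambda>e. ln (p (shift_by J v e) / p e))"
    and integral_ln_density_ratio: "(\<integral>e. - ln (p (shift_by J v e) / p e) \<partial>\<nu>) \<le> \<tau> / 2 * (\<Sum>i\<in>J. (v i)\<^sup>2)"
proof -
  \<comment> \<open>The identity also holds where one of the densities vanishes, since division by 0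
    gives 0 and \<open>ln 0 = 0\<close>.\<close>
  have *: "p z * ln (p (shift_by J v z) / p z) = - (ln (p z / p (shift_by J v z)) * p z)" for z
    using ln_inverse[of "p z / p (shift_by J v z)"] p0[of z] p0[of "shift_by J v z"]
    by (cases "p z = 0"; cases "p (shift_by J v z) = 0") (auto simp: ln_div algebra_simps)
  show "integrable \<nu> (\<lambda>e. ln (p (shift_by J v e) / p e))"
    using kl_int[of v] p0 by (subst integrable_density) (auto simp: *)
  show "(\<integral>e. - ln (p (shift_by J v e) / p e) \<partial>\<nu>) \<le> \<tau> / 2 * (\<Sum>i\<in>J. (v i)\<^sup>2)"
    using kl_le[of v] p0 by (subst integral_density) (auto simp: *)
qed

text \<open>The integral is the mass that the translated density puts on the set where
  \<open>p\<close> is positive, which may be less than 1.\<close>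

lemma nn_integral_density_ratio_le: "(\<integral>\<^sup>+e. ennreal (p (shift_by J v e) / p e) \<partial>\<nu>) \<le> 1"
proof -
  have "(\<integral>\<^sup>+e. ennreal (p (shift_by J v e) / p e) \<partial>\<nu>) = (\<integral>\<^sup>+e. ennreal (p e) * ennreal (p (shift_by J v e) / p e) \<partial>\<Lambda>)"
    by (intro nn_integral_density) measurable
  also have "\<dots> \<le> (\<integral>\<^sup>+e. ennreal (p (shift_by J v e)) \<partial>\<Lambda>)"
    by (intro nn_integral_mono density_mult_ratio_le)
  also have "\<dots> = (\<integral>\<^sup>+e. ennreal (p e) \<partial>\<Lambda>)"
    by (intro nn_integral_PiM_lborel_shift_by[OF finJ]) measurable
  also have "\<dots> = 1" using N.emeasure_space_1 by (simp add: emeasure_density)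
  finally show ?thesis .
qed

text \<open>The remainder \<open>r - 1 - ln r\<close> is nonnegative, so it can be integrated by Tonelli before
  \<open>ln r\<close> is known to be integrable.\<close>

lemma nn_integral_density_ratio_remainder_le:
  "(\<integral>\<^sup>+e. ennreal (p (shift_by J v e) / p e - 1 - ln (p (shift_by J v e) / p e)) \<partial>\<nu>)
     \<le> ennreal (\<tau> / 2 * (\<Sum>i\<in>J. (v i)\<^sup>2))"
proof -
  let ?r = "\<lambda>e. p (shift_by J v e) / p e"
  have r0: "0 \<le> ?r e" for e using p0 by simp
  have ir: "integrable \<nu> ?r"
    using r0 nn_integral_density_ratio_le[of v]
    by (intro integrableI_nonneg) (auto intro: le_less_trans)
  have "(\<integral>e. ?r e \<partial>\<nu>) \<le> 1"
    using nn_integral_density_ratio_le[of v] r0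
    by (subst (asm) nn_integral_eq_integral[OF ir]) (auto simp flip: ennreal_1)
  note il = integrable_ln_density_ratio[of v]
  have "(\<integral>\<^sup>+e. ennreal (?r e - 1 - ln (?r e)) \<partial>\<nu>) = ennreal (\<integral>e. ?r e - 1 - ln (?r e) \<partial>\<nu>)"
    using AE_density_ratio_pos[of v]
    by (intro nn_integral_eq_integral Bochner_Integration.integrable_diff ir il)
       (auto elim!: eventually_mono dest: ln_le_minus_one)
  also have "(\<integral>e. ?r e - 1 - ln (?r e) \<partial>\<nu>) = (\<integral>e. ?r e \<partial>\<nu>) - 1 + (\<integral>e. - ln (?r e) \<partial>\<nu>)"
    using ir il N.prob_space by simp
  also have "\<dots> \<le> \<tau> / 2 * (\<Sum>i\<in>J. (v i)\<^sup>2)"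
    using \<open>(\<integral>e. ?r e \<partial>\<nu>) \<le> 1\<close> integral_ln_density_ratio[of v] by simp
  finally show ?thesis by (simp add: ennreal_leI)
qed

text \<open>Both laws have the same input marginal, so their relative entropy is the mean over the
  input of the entropy between the noise and its translate by \<open>w x - w' x\<close>. Fubini's
  theorem for the logarithm requires joint integrability first; it comes from Tonelli's theorem for
  the nonnegative remainder, and \<open>int\<close> makes the resulting bound finite.\<close>

lemma
  assumes w[measurable]: "\<And>i. (\<lambda>x. w x i) \<in> borel_measurable \<mu>" "\<And>i. (\<lambda>x. w' x i) \<in> borel_measurable \<mu>"
    and int: "integrable \<mu> (\<lambda>x. \<Sum>i\<in>J. (w x i - w' x i)\<^sup>2)"
  shows AE_lik_ratio_pos: "AE z in signal_plus_noise \<mu> J p w. 0 < lik_ratio w w' z" (is ?A)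
    and integrable_ln_lik_ratio: "integrable (signal_plus_noise \<mu> J p w) (\<lambda>z. ln (lik_ratio w w' z))" (is ?B)
    and integral_ln_lik_ratio:
      "(\<integral>z. - ln (lik_ratio w w' z) \<partial>signal_plus_noise \<mu> J p w)
        \<le> \<tau> / 2 * (\<integral>x. (\<Sum>i\<in>J. (w x i - w' x i)\<^sup>2) \<partial>\<mu>)" (is ?C)
proof -
  note [measurable] = measurable_lik_ratio[OF w] measurable_signal_plus_noise[OF w(1)]
  define r where "r = (\<lambda>(x, e). p (shift_by J (\<lambda>i. w x i - w' x i) e) / p e)"
  define V where "V x = (\<Sum>i\<in>J. (w x i - w' x i)\<^sup>2)" for x
  have [measurable]: "r \<in> borel_measurable (\<mu> \<Otimes>\<^sub>M \<nu>)" unfolding r_def by measurable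
  have lr: "lik_ratio w w' (case z of (x, e) \<Rightarrow> (x, shift_by J (w x) e)) = r z" if "z \<in> space (\<mu> \<Otimes>\<^sub>M \<nu>)" for z
    using that by (auto simp: r_def lik_ratio_shift_by space_pair_measure)
  have r0: "0 \<le> r z" for z using p0 by (auto simp: r_def split: prod.split)
  have "AE x in \<mu>. AE e in \<nu>. 0 < r (x, e)"
    using AE_density_ratio_pos by (simp add: r_def)
  then have AEr: "AE z in \<mu> \<Otimes>\<^sub>M \<nu>. 0 < r z"
    by (intro AE_pair_measure) measurable
  show ?A unfolding signal_plus_noise_def
    using AEr AE_space[of "\<mu> \<Otimes>\<^sub>M \<nu>"] by (subst AE_distr_iff) (auto elim!: eventually_elim2 simp: lr)
  have "(\<integral>\<^sup>+z. ennreal (r z) \<partial>(\<mu> \<Otimes>\<^sub>M \<nu>)) = (\<integral>\<^sup>+x. \<integral>\<^sup>+e. ennreal (r (x, e)) \<partial>\<nu> \<partial>\<mu>)"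
    by (rule N.nn_integral_fst[symmetric]) measurable
  also have "\<dots> \<le> (\<integral>\<^sup>+x. 1 \<partial>\<mu>)"
    unfolding r_def using nn_integral_density_ratio_le by (intro nn_integral_mono) simp
  also have "\<dots> < \<infinity>" by (simp add: M.emeasure_space_1)
  finally have ir: "integrable (\<mu> \<Otimes>\<^sub>M \<nu>) r" using r0 by (intro integrableI_nonneg) auto
  have "(\<integral>\<^sup>+z. ennreal (r z - 1 - ln (r z)) \<partial>(\<mu> \<Otimes>\<^sub>M \<nu>))
      = (\<integral>\<^sup>+x. \<integral>\<^sup>+e. ennreal (r (x, e) - 1 - ln (r (x, e))) \<partial>\<nu> \<partial>\<mu>)"
    by (rule N.nn_integral_fst[symmetric]) measurable
  also have "\<dots> \<le> (\<integral>\<^sup>+x. ennreal (\<tau> / 2 * V x) \<partial>\<mu>)"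
    unfolding r_def V_def prod.case by (intro nn_integral_mono nn_integral_density_ratio_remainder_le)
  also have "\<dots> < \<infinity>"
    using int \<tau> by (subst nn_integral_eq_integral) (auto simp: V_def intro!: sum_nonneg mult_nonneg_nonneg)
  finally have "integrable (\<mu> \<Otimes>\<^sub>M \<nu>) (\<lambda>z. r z - 1 - ln (r z))"
    using AEr by (intro integrableI_nonneg) (auto elim!: eventually_mono dest: ln_le_minus_one)
  \<comment> \<open>Here \<open>ln r\<close> is written as \<open>(r - 1) - (r - 1 - ln r)\<close>,
    a difference of two integrable functions.\<close>
  from Bochner_Integration.integrable_diff[OF Bochner_Integration.integrable_diff[OF ir integrable_const[of 1]] this]
  have il: "integrable (\<mu> \<Otimes>\<^sub>M \<nu>) (\<lambda>z. ln (r z))" by simp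
  show ?B unfolding signal_plus_noise_def
  proof (subst integrable_distr_eq)
    show "integrable (\<mu> \<Otimes>\<^sub>M \<nu>) (\<lambda>z. ln (lik_ratio w w' (case z of (x, e) \<Rightarrow> (x, shift_by J (w x) e))))"
      by (subst Bochner_Integration.integrable_cong[OF refl, where g="\<lambda>z. ln (r z)"]) (auto simp: il lr)
  qed measurable
  have "(\<integral>z. - ln (lik_ratio w w' z) \<partial>signal_plus_noise \<mu> J p w) = (\<integral>z. - ln (r z) \<partial>(\<mu> \<Otimes>\<^sub>M \<nu>))"
    unfolding signal_plus_noise_def
    by (subst integral_distr) (auto simp: lr cong: Bochner_Integration.integral_cong)
  also have "\<dots> = (\<integral>x. (\<integral>e. - ln (r (x, e)) \<partial>\<nu>) \<partial>\<mu>)"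
    using il by (intro integral_fst'[symmetric] Bochner_Integration.integrable_minus)
  also have "\<dots> \<le> (\<integral>x. \<tau> / 2 * V x \<partial>\<mu>)"
  proof (rule integral_mono)
    show "integrable \<mu> (\<lambda>x. (\<integral>e. - ln (r (x, e)) \<partial>\<nu>))"
      using il by (intro integrable_fst' Bochner_Integration.integrable_minus)
    show "integrable \<mu> (\<lambda>x. \<tau> / 2 * V x)" using int by (simp add: V_def)
    show "(\<integral>e. - ln (r (x, e)) \<partial>\<nu>) \<le> \<tau> / 2 * V x" for x
      unfolding r_def V_def using integral_ln_density_ratio[of "\<lambda>i. w x i - w' x i"] by simp
  qed
  finally show ?C by (simp add: V_def)
qed

end

section \<open>Cylinder sets of the data space\<close>

text \<open>Bessel's inequality, from the nonnegativity of the square of \<open>x - q\<close> for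
  the projection \<open>q\<close>. The right side does not depend on \<open>J\<close>: however many
  coordinates of an output are observed, the entropy is bounded by its full norm.\<close>

lemma sum_inner_orthonormal_le:
  fixes x :: "'a::real_inner"
  assumes "finite J" and on: "\<And>i j. i \<in> J \<Longrightarrow> j \<in> J \<Longrightarrow> y i \<bullet> y j = (if i = j then 1 else 0)"
  shows "(\<Sum>i\<in>J. (x \<bullet> y i)\<^sup>2) \<le> x \<bullet> x"
proof -
  define q where "q = (\<Sum>i\<in>J. (x \<bullet> y i) *\<^sub>R y i)"
  have xq: "x \<bullet> q = (\<Sum>i\<in>J. (x \<bullet> y i)\<^sup>2)"
    by (simp add: q_def inner_sum_right power2_eq_square)
  have "q \<bullet> q = (\<Sum>i\<in>J. \<Sum>j\<in>J. (x \<bullet> y i) * ((x \<bullet> y j) * (y i \<bullet> y j)))"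
    by (simp add: q_def inner_sum_right inner_sum_left sum_distrib_left mult_ac inner_commute)
  also have "\<dots> = (\<Sum>i\<in>J. \<Sum>j\<in>J. if i = j then (x \<bullet> y i)\<^sup>2 else 0)"
    using on by (intro sum.cong refl) (auto simp: power2_eq_square)
  also have "\<dots> = x \<bullet> q" using \<open>finite J\<close> by (simp add: xq)
  finally have "0 \<le> x \<bullet> x - x \<bullet> q"
    using inner_ge_zero[of "x - q"] by (simp add: inner_diff_left inner_diff_right inner_commute)
  then show ?thesis by (simp add: xq)
qed

text \<open>One and the same set of the algebra has to approximate \<open>A\<close> under both
  measures, because a difference of probabilities is to be compared later; hence the sum of the two
  errors is controlled through the induction.\<close>

lemma sigma_sets_approx_algebra:
  fixes \<mu> \<nu> :: "'a measure"
  assumes alg: "algebra S \<A>" and \<mu>: "finite_measure \<mu>" "sets \<mu> = sigma_sets S \<A>"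
    and \<nu>: "finite_measure \<nu>" "sets \<nu> = sigma_sets S \<A>"
    and "A \<in> sigma_sets S \<A>" "e > 0"
  shows "\<exists>B\<in>\<A>. measure \<mu> (sym_diff A B) + measure \<nu> (sym_diff A B) < e"
  using assms(6,7)
proof (induction arbitrary: e)
  case (Basic A)
  then show ?case by (intro bexI[of _ A]) auto
next
  case Empty
  interpret algebra S \<A> by fact
  show ?case using Empty by (intro bexI[of _ "{}"]) auto
next
  case (Compl A)
  interpret algebra S \<A> by fact
  have "A \<subseteq> S" using Compl.hyps sigma_sets_into_sp[OF space_closed] by blast
  from Compl.IH[OF Compl.prems] obtain B where B: "B \<in> \<A>"
    "measure \<mu> (sym_diff A B) + measure \<nu> (sym_diff A B) < e" by blast
  have "sym_diff (S - A) (S - B) = sym_diff A B"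
    using \<open>A \<subseteq> S\<close> B(1) sets_into_space by blast
  then show ?case using B by (intro bexI[of _ "S - B"]) auto
next
  case (Union a)
  interpret algebra S \<A> by fact
  interpret \<mu>: finite_measure \<mu> by fact
  interpret \<nu>: finite_measure \<nu> by fact
  have a\<mu>[measurable]: "a i \<in> sets \<mu>" and a\<nu>[measurable]: "a i \<in> sets \<nu>" for i
    using Union.hyps \<mu> \<nu> by auto
  let ?a = "\<lambda>n. \<Union>i<n. a i"
  have "incseq ?a" by (intro incseq_SucI) (auto simp: lessThan_Suc)
  moreover have "(\<Union>n. ?a n) = (\<Union>i. a i)" by blast
  ultimately have "(\<lambda>n. measure \<mu> (?a n) + measure \<nu> (?a n)) \<longlonglongrightarrow> measure \<mu> (\<Union>i. a i) + measure \<nu> (\<Union>i. a i)"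
    using \<mu>.finite_Lim_measure_incseq[of ?a] \<nu>.finite_Lim_measure_incseq[of ?a]
    by (intro tendsto_add) (auto simp: image_subset_iff)
  from order_tendstoD(1)[OF this, of "measure \<mu> (\<Union>i. a i) + measure \<nu> (\<Union>i. a i) - e / 2"] Union.prems
  obtain n where n: "measure \<mu> (\<Union>i. a i) + measure \<nu> (\<Union>i. a i) - e / 2 < measure \<mu> (?a n) + measure \<nu> (?a n)"
    by (auto simp: eventually_sequentially)
  have d: "measure \<mu> ((\<Union>i. a i) - ?a n) = measure \<mu> (\<Union>i. a i) - measure \<mu> (?a n)"
    "measure \<nu> ((\<Union>i. a i) - ?a n) = measure \<nu> (\<Union>i. a i) - measure \<nu> (?a n)"
    by (auto intro!: \<mu>.finite_measure_Diff \<nu>.finite_measure_Diff)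
  \<comment> \<open>Half of \<open>e\<close> went into replacing the countable union by its first
    \<open>n\<close> members; the other half is shared among these. The denominator has
    \<open>n + 1\<close> because \<open>n\<close> may be 0.\<close>
  have "\<forall>i. \<exists>B\<in>\<A>. measure \<mu> (sym_diff (a i) B) + measure \<nu> (sym_diff (a i) B) < e / (2 * (n + 1))"
    using Union.IH Union.prems by simp
  then obtain B where B: "\<And>i. B i \<in> \<A>"
    "\<And>i. measure \<mu> (sym_diff (a i) (B i)) + measure \<nu> (sym_diff (a i) (B i)) < e / (2 * (n + 1))"
    by metis
  have B\<mu>[measurable]: "B i \<in> sets \<mu>" and B\<nu>[measurable]: "B i \<in> sets \<nu>" for i
    using B(1) \<mu> \<nu> by auto
  let ?B = "\<Union>i<n. B i"
  have sub: "sym_diff (\<Union>i. a i) ?B \<subseteq> ((\<Union>i. a i) - ?a n) \<union> (\<Union>i<n. sym_diff (a i) (B i))"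
    by blast
  have "measure \<mu> (sym_diff (\<Union>i. a i) ?B)
      \<le> measure \<mu> (((\<Union>i. a i) - ?a n) \<union> (\<Union>i<n. sym_diff (a i) (B i)))"
    by (intro \<mu>.finite_measure_mono sub) auto
  also have "\<dots> \<le> measure \<mu> ((\<Union>i. a i) - ?a n) + measure \<mu> (\<Union>i<n. sym_diff (a i) (B i))"
    by (intro measure_Un_le) auto
  also have "\<dots> \<le> measure \<mu> ((\<Union>i. a i) - ?a n) + (\<Sum>i<n. measure \<mu> (sym_diff (a i) (B i)))"
    by (intro add_left_mono \<mu>.finite_measure_subadditive_finite) auto
  finally have 1: "measure \<mu> (sym_diff (\<Union>i. a i) ?B) \<le> \<dots>" .
  have "measure \<nu> (sym_diff (\<Union>i. a i) ?B)
      \<le> measure \<nu> (((\<Union>i. a i) - ?a n) \<union> (\<Union>i<n. sym_diff (a i) (B i)))"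
    by (intro \<nu>.finite_measure_mono sub) auto
  also have "\<dots> \<le> measure \<nu> ((\<Union>i. a i) - ?a n) + measure \<nu> (\<Union>i<n. sym_diff (a i) (B i))"
    by (intro measure_Un_le) auto
  also have "\<dots> \<le> measure \<nu> ((\<Union>i. a i) - ?a n) + (\<Sum>i<n. measure \<nu> (sym_diff (a i) (B i)))"
    by (intro add_left_mono \<nu>.finite_measure_subadditive_finite) auto
  finally have 2: "measure \<nu> (sym_diff (\<Union>i. a i) ?B) \<le> \<dots>" .
  have "(\<Sum>i<n. measure \<mu> (sym_diff (a i) (B i))) + (\<Sum>i<n. measure \<nu> (sym_diff (a i) (B i)))
      \<le> (\<Sum>i<n. e / (2 * (n + 1)))"
    unfolding sum.distrib[symmetric] using B(2) by (intro sum_mono less_imp_le)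
  also have "\<dots> \<le> e / 2"
    using Union.prems by (simp add: field_simps)
  finally have "measure \<mu> (sym_diff (\<Union>i. a i) ?B) + measure \<nu> (sym_diff (\<Union>i. a i) ?B) < e"
    using 1 2 n d by linarith
  then show ?case using B(1) by (intro bexI[of _ ?B]) auto
qed

text \<open>Replacing \<open>A\<close> by an approximating set of the algebra changes the difference
  by at most the sum of the two approximation errors, which is arbitrarily small.\<close>

lemma measure_diff_le_of_algebra:
  fixes \<mu> \<nu> :: "'a measure"
  assumes alg: "algebra S \<A>" and \<mu>: "finite_measure \<mu>" "sets \<mu> = sigma_sets S \<A>"
    and \<nu>: "finite_measure \<nu>" "sets \<nu> = sigma_sets S \<A>"
    and le: "\<And>B. B \<in> \<A> \<Longrightarrow> measure \<mu> B - measure \<nu> B \<le> \<delta>" and A: "A \<in> sigma_sets S \<A>"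
  shows "measure \<mu> A - measure \<nu> A \<le> \<delta>"
proof (rule field_le_epsilon)
  fix e :: real assume "e > 0"
  from sigma_sets_approx_algebra[OF alg \<mu> \<nu> A this] obtain B where B: "B \<in> \<A>"
    "measure \<mu> (sym_diff A B) + measure \<nu> (sym_diff A B) < e" by blast
  interpret \<mu>: finite_measure \<mu> by fact
  interpret \<nu>: finite_measure \<nu> by fact
  have [measurable]: "A \<in> sets \<mu>" "B \<in> sets \<mu>" "A \<in> sets \<nu>" "B \<in> sets \<nu>"
    using A B(1) \<mu> \<nu> by auto
  have "measure \<mu> A \<le> measure \<mu> (B \<union> sym_diff A B)" by (intro \<mu>.finite_measure_mono) auto
  also have "\<dots> \<le> measure \<mu> B + measure \<mu> (sym_diff A B)" by (intro measure_Un_le) auto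
  finally have 1: "measure \<mu> A \<le> \<dots>" .
  have "measure \<nu> B \<le> measure \<nu> (A \<union> sym_diff A B)" by (intro \<nu>.finite_measure_mono) auto
  also have "\<dots> \<le> measure \<nu> A + measure \<nu> (sym_diff A B)" by (intro measure_Un_le) auto
  finally show "measure \<mu> A - measure \<nu> A \<le> \<delta> + e" using 1 le[OF B(1)] B(2) by linarith
qed

section \<open>Truncations of the data to finitely many output coordinates\<close>

definition truncate_data ::
    "nat set \<Rightarrow> nat \<Rightarrow> (nat \<Rightarrow> 'x::banach \<times> (nat \<Rightarrow> real)) \<Rightarrow> nat \<Rightarrow> 'x \<times> (nat \<Rightarrow> real)" where
  "truncate_data J M \<omega> = (\<lambda>m\<in>{1..M}. (fst (\<omega> m), restrict (snd (\<omega> m)) J))"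

lemma measurable_data_component:
  "m \<in> {1..M} \<Longrightarrow> (\<lambda>\<omega>. \<omega> m) \<in> measurable (data_space I M) (borel \<Otimes>\<^sub>M (\<Pi>\<^sub>M i\<in>I. borel))"
  unfolding data_space_def by (rule measurable_component_singleton)

lemma measurable_truncate_data:
  assumes "J \<subseteq> I"
  shows "truncate_data J M \<in> measurable (data_space I M) (data_space J M)"
  unfolding truncate_data_def data_space_def[of J]
  by (intro measurable_restrict measurable_Pair measurable_compose[OF measurable_data_component measurable_fst]
      measurable_compose[OF measurable_compose[OF measurable_data_component measurable_snd]
        measurable_restrict_subset[OF assms]])

lemma truncate_data_truncate_data:
  "J \<subseteq> J' \<Longrightarrow> truncate_data J M (truncate_data J' M \<omega>) = truncate_data J M \<omega>"
  by (auto simp: truncate_data_def fun_eq_iff restrict_def)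

lemma truncate_data_data: "J \<subseteq> I \<Longrightarrow> truncate_data J M (data R us \<epsilon>s I y M \<phi> \<omega>) = data R us \<epsilon>s J y M \<phi> \<omega>"
  by (auto simp: truncate_data_def data_def fun_eq_iff)

text \<open>The events that depend on the inputs and on the output coordinates in a single
  \<open>J N\<close>. Inputs are never truncated, since (B2) restricts only the noise to finitely
  many coordinates.\<close>

definition cylinders :: "(nat \<Rightarrow> nat set) \<Rightarrow> nat set \<Rightarrow> nat \<Rightarrow> (nat \<Rightarrow> 'x::banach \<times> (nat \<Rightarrow> real)) set set" where
  "cylinders J I M =
     {truncate_data (J N) M -` B \<inter> space (data_space I M) | N B. B \<in> sets (data_space (J N) M)}"

text \<open>Two cylinders can thus be described at the larger of their levels, where their union is
  formed.\<close>

lemma cylinders_mono: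
  assumes "J N \<subseteq> J N'" "J N' \<subseteq> I" "B \<in> sets (data_space (J N) M)"
  shows "\<exists>B'\<in>sets (data_space (J N') M).
    truncate_data (J N) M -` B \<inter> space (data_space I M) = truncate_data (J N') M -` B' \<inter> space (data_space I M)"
proof (intro bexI)
  let ?B' = "truncate_data (J N) M -` B \<inter> space (data_space (J N') M)"
  show "?B' \<in> sets (data_space (J N') M)"
    using assms by (intro measurable_sets[OF measurable_truncate_data])
  show "truncate_data (J N) M -` B \<inter> space (data_space I M) = truncate_data (J N') M -` ?B' \<inter> space (data_space I M)"
    using assms measurable_space[OF measurable_truncate_data[of "J N'" I M]]
    by (auto simp: truncate_data_truncate_data)
qed

text \<open>Monotonicity of \<open>J\<close> makes the cylinders an algebra. They generate because
  each input and each single output coordinate is already a function of some truncation, so that the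
  identity map from the generated sigma-algebra to the data space is measurable.\<close>

lemma
  assumes J: "incseq J" and I: "(\<Union>N. J N) = I"
  shows algebra_cylinders: "algebra (space (data_space I M :: (nat \<Rightarrow> 'a::banach \<times> (nat \<Rightarrow> real)) measure)) (cylinders J I M)"
    and sigma_sets_cylinders:
      "sigma_sets (space (data_space I M :: (nat \<Rightarrow> 'a::banach \<times> (nat \<Rightarrow> real)) measure)) (cylinders J I M) = sets (data_space I M)"
proof -
  let ?D = "data_space I M :: (nat \<Rightarrow> 'a \<times> (nat \<Rightarrow> real)) measure"
  let ?C = "cylinders J I M :: (nat \<Rightarrow> 'a \<times> (nat \<Rightarrow> real)) set set"
  have sub: "J N \<subseteq> I" for N using I by auto
  have cyl: "truncate_data (J N) M -` B \<inter> space ?D \<in> ?C" if "B \<in> sets (data_space (J N) M)" for N B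
    using that by (auto simp: cylinders_def)
  have C_sets: "?C \<subseteq> sets ?D"
    using measurable_sets[OF measurable_truncate_data[OF sub]] by (auto simp: cylinders_def)
  show "algebra (space ?D) ?C"
    unfolding algebra_iff_Un
  proof (intro conjI ballI)
    show "?C \<subseteq> Pow (space ?D)" by (auto simp: cylinders_def)
    show "{} \<in> ?C" using cyl[of "{}" 0] by simp
  next
    fix a assume "a \<in> ?C"
    then obtain N B where B: "B \<in> sets (data_space (J N) M)" "a = truncate_data (J N) M -` B \<inter> space ?D"
      by (auto simp: cylinders_def)
    have "space ?D - a = truncate_data (J N) M -` (space (data_space (J N) M) - B) \<inter> space ?D"
      using measurable_space[OF measurable_truncate_data[OF sub]] by (auto simp: B)
    then show "space ?D - a \<in> ?C" using cyl[of "space (data_space (J N) M) - B" N] B by auto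
  next
    fix a b assume "a \<in> ?C" "b \<in> ?C"
    then obtain N A N' B where A: "A \<in> sets (data_space (J N) M)" "a = truncate_data (J N) M -` A \<inter> space ?D"
      and B: "B \<in> sets (data_space (J N') M)" "b = truncate_data (J N') M -` B \<inter> space ?D"
      by (auto simp: cylinders_def)
    let ?n = "max N N'"
    have "J N \<subseteq> J ?n" "J N' \<subseteq> J ?n" using J by (auto simp: incseq_def)
    from cylinders_mono[of J, OF this(1) sub A(1)] cylinders_mono[of J, OF this(2) sub B(1)]
    obtain A' B' where AB: "A' \<in> sets (data_space (J ?n) M)" "a = truncate_data (J ?n) M -` A' \<inter> space ?D"
      "B' \<in> sets (data_space (J ?n) M)" "b = truncate_data (J ?n) M -` B' \<inter> space ?D"
      using A(2) B(2) by auto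
    have "a \<union> b = truncate_data (J ?n) M -` (A' \<union> B') \<inter> space ?D" using AB by blast
    then show "a \<union> b \<in> ?C" using cyl[of "A' \<union> B'" ?n] AB by auto
  qed
  let ?S = "sigma (space ?D) ?C"
  have CP: "?C \<subseteq> Pow (space ?D)" by (auto simp: cylinders_def)
  have tr: "truncate_data (J N) M \<in> measurable ?S (data_space (J N) M)" for N
    using measurable_space[OF measurable_truncate_data[OF sub]] cyl
    by (intro measurableI) (auto simp: space_measure_of[OF CP] sets_measure_of[OF CP])
  have comp: "(\<lambda>\<omega>. \<omega> m) \<in> measurable ?S (borel \<Otimes>\<^sub>M (\<Pi>\<^sub>M i\<in>I. borel))" if m: "m \<in> {1..M}" for m
  proof (rule measurable_pair)
    have c: "(\<lambda>\<omega>. truncate_data (J N) M \<omega> m) \<in> measurable ?S (borel \<Otimes>\<^sub>M (\<Pi>\<^sub>M i\<in>J N. borel))" for N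
      by (rule measurable_compose[OF tr measurable_data_component[OF m]])
    \<comment> \<open>Every truncation retains the whole input, so level 0 suffices here.\<close>
    show "fst \<circ> (\<lambda>\<omega>. \<omega> m) \<in> measurable ?S borel"
      using measurable_compose[OF c[of 0] measurable_fst] m by (simp add: truncate_data_def comp_def)
    have "(\<lambda>\<omega>. \<lambda>i\<in>I. snd (\<omega> m) i) \<in> measurable ?S (\<Pi>\<^sub>M i\<in>I. borel)"
    proof (rule measurable_restrict)
      fix i assume "i \<in> I"
      then obtain N where i: "i \<in> J N" using I by auto
      show "(\<lambda>\<omega>. snd (\<omega> m) i) \<in> measurable ?S borel"
        using measurable_compose[OF measurable_compose[OF c measurable_snd] measurable_component_singleton[OF i]] m i
        by (simp add: truncate_data_def)
    qed
    then show "snd \<circ> (\<lambda>\<omega>. \<omega> m) \<in> measurable ?S (\<Pi>\<^sub>M i\<in>I. borel)"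
    proof (rule measurable_cong[THEN iffD1, rotated])
      fix \<omega> assume "\<omega> \<in> space ?S"
      then have "\<omega> \<in> space ?D" by (simp add: space_measure_of[OF CP])
      then have "\<omega> m \<in> space (borel \<Otimes>\<^sub>M (\<Pi>\<^sub>M i\<in>I. borel))" using m by (auto simp: data_space_def space_PiM)
      then show "(\<lambda>i\<in>I. snd (\<omega> m) i) = (snd \<circ> (\<lambda>\<omega>. \<omega> m)) \<omega>"
        by (auto simp: space_pair_measure space_PiM PiE_def extensional_restrict)
    qed
  qed
  have "(\<lambda>\<omega>. \<lambda>m\<in>{1..M}. \<omega> m) \<in> measurable ?S (\<Pi>\<^sub>M m\<in>{1..M}. borel \<Otimes>\<^sub>M (\<Pi>\<^sub>M i\<in>I. borel))"
    by (intro measurable_restrict comp)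
  then have "(\<lambda>\<omega>. \<lambda>m\<in>{1..M}. \<omega> m) \<in> measurable ?S ?D"
    by (simp only: data_space_def)
  moreover have "(\<lambda>m\<in>{1..M}. \<omega> m) = \<omega>" if "\<omega> \<in> space ?S" for \<omega>
  proof -
    have "\<omega> \<in> space ?D" using that by (simp only: space_measure_of[OF CP])
    then show "(\<lambda>m\<in>{1..M}. \<omega> m) = \<omega>" by (simp add: data_space_def space_PiM PiE_def extensional_restrict)
  qed
  ultimately have id: "(\<lambda>\<omega>. \<omega>) \<in> measurable ?S ?D"
    by (subst measurable_cong[where g="\<lambda>\<omega>. \<lambda>m\<in>{1..M}. \<omega> m"]) auto
  have "A \<in> sigma_sets (space ?D) ?C" if "A \<in> sets ?D" for A
    using measurable_sets[OF id that] sets.sets_into_space[OF that]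
    by (simp add: space_measure_of[OF CP] sets_measure_of[OF CP] Int_absorb2)
  then show "sigma_sets (space ?D) ?C = sets ?D"
    using sets.sigma_sets_subset[OF C_sets] by auto
qed

section \<open>Square-integrable functions and the Sobolev ball\<close>

lemma L2_measurable: "f \<in> L2 \<rho> \<Longrightarrow> f \<in> borel_measurable \<rho>"
  by (simp add: L2_def)

lemma integrable_L2_mult:
  assumes "f \<in> L2 \<rho>" "g \<in> L2 \<rho>"
  shows "integrable \<rho> (\<lambda>x. f x * g x)"
proof (rule Bochner_Integration.integrable_bound)
  show "integrable \<rho> (\<lambda>x. (f x)\<^sup>2 + (g x)\<^sup>2)" using assms by (simp add: L2_def)
  have [measurable]: "f \<in> borel_measurable \<rho>" "g \<in> borel_measurable \<rho>" using assms by (auto simp: L2_def)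
  show "(\<lambda>x. f x * g x) \<in> borel_measurable \<rho>" by measurable
  show "AE x in \<rho>. norm (f x * g x) \<le> norm ((f x)\<^sup>2 + (g x)\<^sup>2)"
  proof (intro AE_I2)
    fix x
    have "2 * \<bar>f x * g x\<bar> \<le> (f x)\<^sup>2 + (g x)\<^sup>2"
      using sum_squares_bound[of "\<bar>f x\<bar>" "\<bar>g x\<bar>"] by (simp add: abs_mult)
    then show "norm (f x * g x) \<le> norm ((f x)\<^sup>2 + (g x)\<^sup>2)" by simp
  qed
qed

lemma L2_lincomb:
  assumes "f \<in> L2 \<rho>" "g \<in> L2 \<rho>"
  shows "(\<lambda>x. c * f x + d * g x) \<in> L2 \<rho>"
proof -
  have [measurable]: "f \<in> borel_measurable \<rho>" "g \<in> borel_measurable \<rho>" using assms by (auto simp: L2_def)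
  have "integrable \<rho> (\<lambda>x. c\<^sup>2 * (f x * f x) + d\<^sup>2 * (g x * g x) + 2 * c * d * (f x * g x))"
    using assms by (intro Bochner_Integration.integrable_add integrable_mult_right integrable_L2_mult)
  also have "(\<lambda>x. c\<^sup>2 * (f x * f x) + d\<^sup>2 * (g x * g x) + 2 * c * d * (f x * g x)) = (\<lambda>x. (c * f x + d * g x)\<^sup>2)"
    by (auto simp: power2_eq_square algebra_simps)
  finally show ?thesis by (simp add: L2_def)
qed

lemma L2_diff: "f \<in> L2 \<rho> \<Longrightarrow> g \<in> L2 \<rho> \<Longrightarrow> (\<lambda>x. f x - g x) \<in> L2 \<rho>"
  using L2_lincomb[of f \<rho> g 1 "-1"] by simp

lemma L2_sum:
  assumes "finite J" "\<And>k. k \<in> J \<Longrightarrow> f k \<in> L2 \<rho>"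
  shows "(\<lambda>x. \<Sum>k\<in>J. c k * f k x) \<in> L2 \<rho>"
  using assms
proof (induction J rule: finite_induct)
  case empty
  then show ?case by (simp add: L2_def)
next
  case (insert j J)
  then show ?case using L2_lincomb[of "f j" \<rho> "\<lambda>x. \<Sum>k\<in>J. c k * f k x" "c j" 1] by simp
qed

lemma l2_inner_commute: "l2_inner \<rho> f g = l2_inner \<rho> g f"
  by (simp add: l2_inner_def mult.commute)

lemma l2_inner_nonneg: "0 \<le> l2_inner \<rho> f f"
  by (simp add: l2_inner_def)

lemma l2_norm_squared: "(l2_norm \<rho> f)\<^sup>2 = l2_inner \<rho> f f"
  by (simp add: l2_norm_def l2_inner_nonneg)

lemma l2_inner_diff_left:
  assumes "f \<in> L2 \<rho>" "g \<in> L2 \<rho>" "h \<in> L2 \<rho>"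
  shows "l2_inner \<rho> (\<lambda>x. f x - g x) h = l2_inner \<rho> f h - l2_inner \<rho> g h"
  using assms by (simp add: l2_inner_def left_diff_distrib integrable_L2_mult Bochner_Integration.integral_diff)

lemma l2_inner_sum_left:
  assumes "\<And>k. k \<in> J \<Longrightarrow> f k \<in> L2 \<rho>" "h \<in> L2 \<rho>"
  shows "l2_inner \<rho> (\<lambda>x. \<Sum>k\<in>J. c k * f k x) h = (\<Sum>k\<in>J. c k * l2_inner \<rho> (f k) h)"
  using assms integrable_L2_mult[of _ \<rho> h]
  by (simp add: l2_inner_def sum_distrib_right mult.assoc Bochner_Integration.integral_sum)

text \<open>The index type is left open so that a single unit vector is also an instance, indexed by
  \<open>unit\<close>.\<close>

definition orthonormal_family :: "'d measure \<Rightarrow> 'i set \<Rightarrow> ('i \<Rightarrow> 'd \<Rightarrow> real) \<Rightarrow> bool" where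
  "orthonormal_family \<rho> J \<psi> \<longleftrightarrow> (\<forall>k\<in>J. \<psi> k \<in> L2 \<rho>) \<and>
     (\<forall>j\<in>J. \<forall>k\<in>J. l2_inner \<rho> (\<psi> j) (\<psi> k) = (if j = k then 1 else 0))"

lemma l2_inner_sum_orthonormal:
  assumes "orthonormal_family \<rho> J \<psi>" "finite J" "k \<in> J"
  shows "l2_inner \<rho> (\<lambda>x. \<Sum>k\<in>J. c k * \<psi> k x) (\<psi> k) = c k"
proof -
  have "l2_inner \<rho> (\<lambda>x. \<Sum>k\<in>J. c k * \<psi> k x) (\<psi> k) = (\<Sum>j\<in>J. c j * l2_inner \<rho> (\<psi> j) (\<psi> k))"
    using assms by (intro l2_inner_sum_left) (auto simp: orthonormal_family_def)
  also have "\<dots> = (\<Sum>j\<in>J. if j = k then c k else 0)"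
    using assms by (intro sum.cong) (auto simp: orthonormal_family_def)
  finally show ?thesis using assms by simp
qed

text \<open>Elements of \<open>L2\<close> are functions, not classes in an inner product space type,
  so the projection argument is carried out with \<open>l2_inner\<close>. It needs an orthonormal
  family only, not a basis.\<close>

lemma l2_bessel:
  assumes on: "orthonormal_family \<rho> J \<psi>" and J: "finite J" and f: "f \<in> L2 \<rho>"
  shows "(\<Sum>k\<in>J. (l2_inner \<rho> f (\<psi> k))\<^sup>2) \<le> l2_inner \<rho> f f"
proof -
  define q where "q = (\<lambda>x. \<Sum>k\<in>J. l2_inner \<rho> f (\<psi> k) * \<psi> k x)"
  have \<psi>: "\<psi> k \<in> L2 \<rho>" if "k \<in> J" for k using that on by (auto simp: orthonormal_family_def)
  have q: "q \<in> L2 \<rho>" unfolding q_def by (intro L2_sum J \<psi>)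
  have qh: "l2_inner \<rho> q h = (\<Sum>k\<in>J. l2_inner \<rho> f (\<psi> k) * l2_inner \<rho> (\<psi> k) h)" if "h \<in> L2 \<rho>" for h
    unfolding q_def using that by (intro l2_inner_sum_left \<psi>)
  have qk: "l2_inner \<rho> (\<psi> k) q = l2_inner \<rho> f (\<psi> k)" if "k \<in> J" for k
    using l2_inner_sum_orthonormal[OF on J that] by (subst l2_inner_commute) (simp add: q_def)
  have "0 \<le> l2_inner \<rho> (\<lambda>x. f x - q x) (\<lambda>x. f x - q x)" by (rule l2_inner_nonneg)
  also have "\<dots> = l2_inner \<rho> f f - 2 * l2_inner \<rho> q f + l2_inner \<rho> q q"
    using f q L2_diff[OF f q]
    by (simp add: l2_inner_diff_left l2_inner_commute[of \<rho> f "\<lambda>x. f x - q x"]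
        l2_inner_commute[of \<rho> q "\<lambda>x. f x - q x"] l2_inner_commute[of \<rho> f q])
  also have "l2_inner \<rho> q q = (\<Sum>k\<in>J. (l2_inner \<rho> f (\<psi> k))\<^sup>2)"
    using qh[OF q] qk by (simp add: power2_eq_square)
  also have "l2_inner \<rho> q f = (\<Sum>k\<in>J. (l2_inner \<rho> f (\<psi> k))\<^sup>2)"
    using qh[OF f] by (simp add: power2_eq_square l2_inner_commute[of \<rho> _ f])
  finally show ?thesis by simp
qed

text \<open>Reading off the sign of one coefficient of an estimate is a measurable test, because an
  open half-space belongs to the generating topology.\<close>

lemma halfspace_in_L2_borel:
  assumes \<psi>: "\<psi> \<in> L2 \<rho>" "l2_inner \<rho> \<psi> \<psi> = 1"
  shows "{f \<in> L2 \<rho>. 0 < l2_inner \<rho> f \<psi>} \<in> sets (L2_borel \<rho>)"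
proof -
  have "\<exists>e>0. \<forall>g\<in>L2 \<rho>. l2_dist \<rho> f g < e \<longrightarrow> 0 < l2_inner \<rho> g \<psi>"
    if f: "f \<in> L2 \<rho>" "0 < l2_inner \<rho> f \<psi>" for f
  proof (intro exI conjI ballI impI)
    \<comment> \<open>The radius is the value of the functional at \<open>f\<close>, that is, the
      distance of \<open>f\<close> from the bounding hyperplane, as \<open>\<psi>\<close> is a unit
      vector.\<close>
    fix g assume g: "g \<in> L2 \<rho>" "l2_dist \<rho> f g < l2_inner \<rho> f \<psi>"
    have "(l2_inner \<rho> (\<lambda>x. f x - g x) \<psi>)\<^sup>2 \<le> (l2_dist \<rho> f g)\<^sup>2"
      \<comment> \<open>Bessel's inequality for one unit vector is the Cauchy-Schwarz inequality
        needed here.\<close>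
      using l2_bessel[of \<rho> "{()}" "\<lambda>_. \<psi>", OF _ _ L2_diff[OF f(1) g(1)]] \<psi>
      by (simp add: orthonormal_family_def l2_dist_def l2_norm_squared)
    moreover have "0 \<le> l2_dist \<rho> f g"
      by (simp add: l2_dist_def l2_norm_def l2_inner_nonneg)
    ultimately have "\<bar>l2_inner \<rho> (\<lambda>x. f x - g x) \<psi>\<bar> \<le> l2_dist \<rho> f g"
      unfolding abs_le_square_iff[symmetric] by simp
    then show "0 < l2_inner \<rho> g \<psi>"
      using g f \<psi> by (simp add: l2_inner_diff_left)
  qed (use f in auto)
  then show ?thesis unfolding L2_borel_def by (intro in_measure_of) auto
qed

lemma space_L2_borel: "space (L2_borel \<rho>) = L2 \<rho>"
  unfolding L2_borel_def by (intro space_measure_of) auto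

text \<open>The coefficients are extended by 0 outside \<open>J\<close>; the partial sums are then
  eventually constant and the series reduces to a finite sum.\<close>

lemma sum_in_sobolev_ball:
  assumes \<psi>: "\<And>k. k \<in> J \<Longrightarrow> \<psi> k \<in> L2 \<rho>" and J: "finite J" "J \<subseteq> {1..}"
    and le: "(\<Sum>k\<in>J. lam k powr (-\<beta>) * (c k)\<^sup>2) \<le> L\<^sup>2"
  shows "(\<lambda>x. \<Sum>k\<in>J. c k * \<psi> k x) \<in> sobolev_ball \<rho> lam \<psi> \<beta> L"
proof -
  define \<theta> where "\<theta> k = (if k \<in> J then c k else 0)" for k
  have sum_eq: "(\<Sum>k=1..n. \<theta> k * \<psi> k x) = (\<Sum>k\<in>J. c k * \<psi> k x)" if "n \<ge> Max (insert 0 J)" for n x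
  proof (rule sum.mono_neutral_cong_right)
    show "J \<subseteq> {1..n}" using that J by auto
  qed (auto simp: \<theta>_def)
  have "(\<lambda>n. l2_dist \<rho> (\<lambda>x. \<Sum>k=1..n. \<theta> k * \<psi> k x) (\<lambda>x. \<Sum>k\<in>J. c k * \<psi> k x)) \<longlonglongrightarrow> 0"
    by (intro tendsto_eventually eventually_sequentiallyI[of "Max (insert 0 J)"])
       (simp add: sum_eq[unfolded One_nat_def] l2_dist_def l2_norm_def l2_inner_def)
  moreover have "(\<lambda>k. lam k powr (-\<beta>) * (\<theta> k)\<^sup>2) summable_on {1..} \<longleftrightarrow>
      (\<lambda>k. lam k powr (-\<beta>) * (\<theta> k)\<^sup>2) summable_on J"
    using J by (intro summable_on_cong_neutral) (auto simp: \<theta>_def)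
  moreover have "(\<Sum>\<^sub>\<infinity>k\<in>{1..}. lam k powr (-\<beta>) * (\<theta> k)\<^sup>2) = (\<Sum>\<^sub>\<infinity>k\<in>J. lam k powr (-\<beta>) * (c k)\<^sup>2)"
    using J by (intro infsum_cong_neutral) (auto simp: \<theta>_def)
  ultimately show ?thesis
    using J le L2_sum[OF J(1) \<psi>, where c=c] unfolding sobolev_ball_def by (auto intro!: exI[of _ \<theta>])
qed

section \<open>The regression model\<close>

text \<open>Independence of the generated sigma-algebras is the product formula on rectangles, and
  these determine the joint law.\<close>

lemma (in prob_space) distr_pair_eq_pair_measure:
  assumes X: "X \<in> measurable M S" and Y: "Y \<in> measurable M T"
    and ind: "\<And>A B. A \<in> sets S \<Longrightarrow> B \<in> sets T \<Longrightarrow>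
      prob ((X -` A \<inter> space M) \<inter> (Y -` B \<inter> space M)) = prob (X -` A \<inter> space M) * prob (Y -` B \<inter> space M)"
  shows "distr M (S \<Otimes>\<^sub>M T) (\<lambda>\<omega>. (X \<omega>, Y \<omega>)) = distr M S X \<Otimes>\<^sub>M distr M T Y"
proof (rule pair_measure_eqI[symmetric])
  interpret X: prob_space "distr M S X" by (rule prob_space_distr[OF X])
  interpret Y: prob_space "distr M T Y" by (rule prob_space_distr[OF Y])
  show "sigma_finite_measure (distr M S X)" "sigma_finite_measure (distr M T Y)" by unfold_locales
  show "sets (distr M S X \<Otimes>\<^sub>M distr M T Y) = sets (distr M (S \<Otimes>\<^sub>M T) (\<lambda>\<omega>. (X \<omega>, Y \<omega>)))"
    by (simp cong: sets_pair_measure_cong)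
  fix A B assume "A \<in> sets (distr M S X)" "B \<in> sets (distr M T Y)"
  then have AB: "A \<in> sets S" "B \<in> sets T" by simp_all
  have "emeasure (distr M (S \<Otimes>\<^sub>M T) (\<lambda>\<omega>. (X \<omega>, Y \<omega>))) (A \<times> B)
      = emeasure M ((\<lambda>\<omega>. (X \<omega>, Y \<omega>)) -` (A \<times> B) \<inter> space M)"
    using AB by (intro emeasure_distr measurable_Pair X Y pair_measureI)
  also have "(\<lambda>\<omega>. (X \<omega>, Y \<omega>)) -` (A \<times> B) \<inter> space M = (X -` A \<inter> space M) \<inter> (Y -` B \<inter> space M)"
    by auto
  also have "emeasure M \<dots> = emeasure (distr M S X) A * emeasure (distr M T Y) B"
    using AB by (simp add: emeasure_distr X Y emeasure_eq_measure ind ennreal_mult)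
  finally show "emeasure (distr M S X) A * emeasure (distr M T Y) B
      = emeasure (distr M (S \<Otimes>\<^sub>M T) (\<lambda>\<omega>. (X \<omega>, Y \<omega>))) (A \<times> B)" ..
qed

locale regression_model = prob_space \<Omega>
  for \<Omega> :: "'w measure" +
  fixes \<rho> :: "'d measure"
    and R :: "('d \<Rightarrow> real) \<Rightarrow> 'x::banach \<Rightarrow> 'y::{real_inner, polish_space}"
    and u :: "'w \<Rightarrow> 'x" and \<epsilon> :: "'y \<Rightarrow> 'w \<Rightarrow> real"
    and us :: "nat \<Rightarrow> 'w \<Rightarrow> 'x" and \<epsilon>s :: "nat \<Rightarrow> 'y \<Rightarrow> 'w \<Rightarrow> real"
    and Lop :: "('d \<Rightarrow> real) \<Rightarrow> ('d \<Rightarrow> real)"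
    and I :: "nat set" and y :: "nat \<Rightarrow> 'y" and \<tau> :: real
    and lam :: "nat \<Rightarrow> real" and \<psi> :: "nat \<Rightarrow> 'd \<Rightarrow> real"
  assumes u[measurable]: "u \<in> borel_measurable \<Omega>"
    and forward: "forward_operator \<rho> R"
    and normal: "is_normal_operator \<Omega> \<rho> R u Lop"
    and noise: "linear_noise \<Omega> \<epsilon>" and indep: "indep_of_input \<Omega> u \<epsilon>"
    and onb: "orthonormal_basis I y"
    and \<tau>: "\<tau> > 0" and dens: "noise_density_bound \<Omega> \<epsilon> I y \<tau>"
    and iid: "iid_copies \<Omega> u \<epsilon> us \<epsilon>s"
    and eig: "positive_eigensystem \<rho> Lop lam \<psi>"
begin

definition signal :: "('d \<Rightarrow> real) \<Rightarrow> 'x \<Rightarrow> nat \<Rightarrow> real" where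
  "signal \<phi> x i = R \<phi> x \<bullet> y i"

lemma measurable_R: "\<phi> \<in> L2 \<rho> \<Longrightarrow> R \<phi> \<in> borel_measurable borel"
  using forward unfolding forward_operator_def by blast

lemma measurable_signal: "\<phi> \<in> L2 \<rho> \<Longrightarrow> (\<lambda>x. signal \<phi> x i) \<in> borel_measurable borel"
  unfolding signal_def by (rule borel_measurable_inner[OF measurable_R borel_measurable_const])

lemma R_diff:
  assumes "\<phi> \<in> L2 \<rho>" "\<phi>' \<in> L2 \<rho>"
  shows "R (\<lambda>x. \<phi> x - \<phi>' x) v = R \<phi> v - R \<phi>' v"
proof -
  have "R (\<lambda>x. 1 * \<phi> x + (-1) * \<phi>' x) v = 1 *\<^sub>R R \<phi> v + (-1) *\<^sub>R R \<phi>' v"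
    using forward assms unfolding forward_operator_def by blast
  then show ?thesis by simp
qed

text \<open>Linearity turns the difference of the two signals into the signal of
  \<open>\<zeta>\<close>; Bessel's inequality bounds its observed coordinates by the norm of
  \<open>R \<zeta>\<close>, whose mean square is the quadratic form of the normal operator. This is
  the only place where the entropy bound meets the operator.\<close>

lemma
  assumes J: "finite J" "J \<subseteq> I" and \<phi>: "\<phi> \<in> L2 \<rho>" "\<phi>' \<in> L2 \<rho>"
  defines "\<zeta> \<equiv> \<lambda>x. \<phi> x - \<phi>' x"
  shows integrable_signal_diff:
      "integrable (distr \<Omega> borel u) (\<lambda>x. \<Sum>i\<in>J. (signal \<phi> x i - signal \<phi>' x i)\<^sup>2)"
    and integral_signal_diff_le:
      "(\<integral>x. (\<Sum>i\<in>J. (signal \<phi> x i - signal \<phi>' x i)\<^sup>2) \<partial>distr \<Omega> borel u) \<le> l2_inner \<rho> (Lop \<zeta>) \<zeta>"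
proof -
  note [measurable] = measurable_signal[OF \<phi>(1)] measurable_signal[OF \<phi>(2)]
  have \<zeta>: "\<zeta> \<in> L2 \<rho>" unfolding \<zeta>_def by (intro L2_diff \<phi>)
  have int: "integrable \<Omega> (\<lambda>\<omega>. R \<zeta> (u \<omega>) \<bullet> R \<zeta> (u \<omega>))"
    and val: "l2_inner \<rho> (Lop \<zeta>) \<zeta> = (\<integral>\<omega>. R \<zeta> (u \<omega>) \<bullet> R \<zeta> (u \<omega>) \<partial>\<Omega>)"
    using normal \<zeta> unfolding is_normal_operator_def by blast+
  have le: "(\<Sum>i\<in>J. (signal \<phi> x i - signal \<phi>' x i)\<^sup>2) \<le> R \<zeta> x \<bullet> R \<zeta> x" for x
  proof -
    have "signal \<phi> x i - signal \<phi>' x i = R \<zeta> x \<bullet> y i" for i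
      unfolding signal_def \<zeta>_def R_diff[OF \<phi>] by (simp add: inner_diff_left)
    moreover have "y i \<bullet> y j = (if i = j then 1 else 0)" if "i \<in> J" "j \<in> J" for i j
      using onb that subsetD[OF J(2)] unfolding orthonormal_basis_def by simp
    note sum_inner_orthonormal_le[OF J(1) this, of "R \<zeta> x"]
    ultimately show ?thesis by simp
  qed
  have int': "integrable \<Omega> (\<lambda>\<omega>. \<Sum>i\<in>J. (signal \<phi> (u \<omega>) i - signal \<phi>' (u \<omega>) i)\<^sup>2)"
  proof (rule Bochner_Integration.integrable_bound[OF int])
    show "AE \<omega> in \<Omega>. norm (\<Sum>i\<in>J. (signal \<phi> (u \<omega>) i - signal \<phi>' (u \<omega>) i)\<^sup>2) \<le> norm (R \<zeta> (u \<omega>) \<bullet> R \<zeta> (u \<omega>))"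
      using le by (intro AE_I2) (simp add: sum_nonneg)
  qed measurable
  then show "integrable (distr \<Omega> borel u) (\<lambda>x. \<Sum>i\<in>J. (signal \<phi> x i - signal \<phi>' x i)\<^sup>2)"
    by (subst integrable_distr_eq) auto
  have "(\<integral>x. (\<Sum>i\<in>J. (signal \<phi> x i - signal \<phi>' x i)\<^sup>2) \<partial>distr \<Omega> borel u)
      = (\<integral>\<omega>. (\<Sum>i\<in>J. (signal \<phi> (u \<omega>) i - signal \<phi>' (u \<omega>) i)\<^sup>2) \<partial>\<Omega>)"
    by (subst integral_distr) auto
  also have "\<dots> \<le> l2_inner \<rho> (Lop \<zeta>) \<zeta>"
    unfolding val by (intro integral_mono int int' le)
  finally show "(\<integral>x. (\<Sum>i\<in>J. (signal \<phi> x i - signal \<phi>' x i)\<^sup>2) \<partial>distr \<Omega> borel u) \<le> l2_inner \<rho> (Lop \<zeta>) \<zeta>" .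
qed

lemma measurable_noise_family: "(\<lambda>\<omega> z. \<epsilon> z \<omega>) \<in> measurable \<Omega> (\<Pi>\<^sub>M z\<in>UNIV. borel)"
proof -
  have "(\<lambda>\<omega>. \<lambda>z\<in>UNIV. \<epsilon> z \<omega>) \<in> measurable \<Omega> (\<Pi>\<^sub>M z\<in>UNIV. borel)"
    using noise by (intro measurable_restrict) (auto simp: linear_noise_def)
  then show ?thesis by (simp add: restrict_def)
qed

lemma distr_input_noise:
  "distr \<Omega> (borel \<Otimes>\<^sub>M (\<Pi>\<^sub>M i\<in>J. lborel)) (\<lambda>\<omega>. (u \<omega>, \<lambda>i\<in>J. \<epsilon> (y i) \<omega>))
    = distr \<Omega> borel u \<Otimes>\<^sub>M distr \<Omega> (\<Pi>\<^sub>M i\<in>J. lborel) (\<lambda>\<omega>. \<lambda>i\<in>J. \<epsilon> (y i) \<omega>)"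
proof (rule distr_pair_eq_pair_measure[OF u])
  have r: "(\<lambda>e. \<lambda>i\<in>J. e (y i)) \<in> measurable (\<Pi>\<^sub>M z\<in>UNIV. borel) (\<Pi>\<^sub>M i\<in>J. lborel :: real measure)"
    by (intro measurable_restrict) simp
  show *: "(\<lambda>\<omega>. \<lambda>i\<in>J. \<epsilon> (y i) \<omega>) \<in> measurable \<Omega> (\<Pi>\<^sub>M i\<in>J. lborel)"
    by (rule measurable_compose[OF measurable_noise_family r])
  fix A B assume A: "A \<in> sets (borel :: 'x measure)" and B: "B \<in> sets (\<Pi>\<^sub>M i\<in>J. lborel :: real measure)"
  \<comment> \<open>An event of finitely many noise coordinates is pulled back to the family of all
    \<open>\<epsilon> z\<close>, for which independence of the input is assumed.\<close>
  let ?B = "(\<lambda>e. \<lambda>i\<in>J. e (y i)) -` B \<inter> space (\<Pi>\<^sub>M z\<in>(UNIV :: 'y set). (borel :: real measure))"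
  have "u -` A \<inter> space \<Omega> \<in> sets (vimage_algebra (space \<Omega>) u borel)"
    by (rule in_vimage_algebra[OF A])
  moreover have "(\<lambda>\<omega> z. \<epsilon> z \<omega>) -` ?B \<inter> space \<Omega> \<in> sets (vimage_algebra (space \<Omega>) (\<lambda>\<omega> z. \<epsilon> z \<omega>) (\<Pi>\<^sub>M z\<in>UNIV. borel))"
    by (rule in_vimage_algebra[OF measurable_sets[OF r B]])
  ultimately have "prob ((u -` A \<inter> space \<Omega>) \<inter> ((\<lambda>\<omega> z. \<epsilon> z \<omega>) -` ?B \<inter> space \<Omega>))
      = prob (u -` A \<inter> space \<Omega>) * prob ((\<lambda>\<omega> z. \<epsilon> z \<omega>) -` ?B \<inter> space \<Omega>)"
    using indep unfolding indep_of_input_def by (intro indep_setD)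
  also have "(\<lambda>\<omega> z. \<epsilon> z \<omega>) -` ?B \<inter> space \<Omega> = (\<lambda>\<omega>. \<lambda>i\<in>J. \<epsilon> (y i) \<omega>) -` B \<inter> space \<Omega>"
    by (auto simp: space_PiM)
  finally show "prob ((u -` A \<inter> space \<Omega>) \<inter> ((\<lambda>\<omega>. \<lambda>i\<in>J. \<epsilon> (y i) \<omega>) -` B \<inter> space \<Omega>))
      = prob (u -` A \<inter> space \<Omega>) * prob ((\<lambda>\<omega>. \<lambda>i\<in>J. \<epsilon> (y i) \<omega>) -` B \<inter> space \<Omega>)" .
qed

text \<open>A sample is written as a fixed measurable function of the pair (input, noise), so that
  independence and equality in law carry over from the pairs to the observations.\<close>

definition sample_map :: "nat set \<Rightarrow> ('d \<Rightarrow> real) \<Rightarrow> 'x \<times> ('y \<Rightarrow> real) \<Rightarrow> 'x \<times> (nat \<Rightarrow> real)" where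
  "sample_map J \<phi> = (\<lambda>(x, e). (x, \<lambda>i\<in>J. signal \<phi> x i + e (y i)))"

lemma measurable_sample_map:
  assumes \<phi>: "\<phi> \<in> L2 \<rho>"
  shows "sample_map J \<phi> \<in> measurable pair_space (borel \<Otimes>\<^sub>M (\<Pi>\<^sub>M i\<in>J. borel))"
proof -
  have "(\<lambda>xe. \<lambda>i\<in>J. signal \<phi> (fst xe) i + snd xe (y i)) \<in> measurable pair_space (\<Pi>\<^sub>M i\<in>J. borel)"
  proof (rule measurable_restrict)
    fix i
    have "(\<lambda>xe. signal \<phi> (fst xe) i) \<in> borel_measurable pair_space"
      unfolding pair_space_def by (rule measurable_compose[OF measurable_fst measurable_signal[OF \<phi>]])
    moreover have "(\<lambda>xe. snd xe (y i)) \<in> borel_measurable pair_space"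
      unfolding pair_space_def
      by (rule measurable_compose[OF measurable_snd measurable_component_singleton]) simp
    ultimately show "(\<lambda>xe. signal \<phi> (fst xe) i + snd xe (y i)) \<in> borel_measurable pair_space"
      by (rule borel_measurable_add)
  qed
  moreover have "fst \<in> measurable pair_space (borel :: 'x measure)"
    unfolding pair_space_def by (rule measurable_fst)
  ultimately have "(\<lambda>xe. (fst xe, \<lambda>i\<in>J. signal \<phi> (fst xe) i + snd xe (y i)))
      \<in> measurable pair_space (borel \<Otimes>\<^sub>M (\<Pi>\<^sub>M i\<in>J. borel))"
    by (rule measurable_Pair[rotated])
  then show ?thesis by (simp add: sample_map_def case_prod_beta')
qed

definition sample :: "nat set \<Rightarrow> ('d \<Rightarrow> real) \<Rightarrow> nat \<Rightarrow> 'w \<Rightarrow> 'x \<times> (nat \<Rightarrow> real)" where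
  "sample J \<phi> m \<omega> = sample_map J \<phi> (us m \<omega>, \<lambda>z. \<epsilon>s m z \<omega>)"

lemma data_eq_samples: "data R us \<epsilon>s J y M \<phi> = (\<lambda>\<omega>. \<lambda>m\<in>{1..M}. sample J \<phi> m \<omega>)"
  by (auto simp: data_def sample_def sample_map_def signal_def observation_def fun_eq_iff)

lemma indep_vars_samples:
  assumes \<phi>: "\<phi> \<in> L2 \<rho>"
  shows "indep_vars (\<lambda>_. borel \<Otimes>\<^sub>M (\<Pi>\<^sub>M i\<in>J. borel)) (sample J \<phi>) {1..M}"
proof -
  have "indep_vars (\<lambda>_. pair_space) (\<lambda>m \<omega>. (us m \<omega>, \<lambda>z. \<epsilon>s m z \<omega>)) {1..M}"
    using iid unfolding iid_copies_def by (auto intro: indep_vars_subset)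
  from indep_vars_compose2[OF this, of "\<lambda>_. sample_map J \<phi>"] measurable_sample_map[OF \<phi>]
  show ?thesis by (simp add: sample_def[abs_def])
qed

lemma measurable_sample:
  "\<phi> \<in> L2 \<rho> \<Longrightarrow> m \<in> {1..M} \<Longrightarrow> sample J \<phi> m \<in> measurable \<Omega> (borel \<Otimes>\<^sub>M (\<Pi>\<^sub>M i\<in>J. borel))"
  using indep_vars_samples[of \<phi> J M] unfolding indep_vars_def by blast

lemma measurable_data: "\<phi> \<in> L2 \<rho> \<Longrightarrow> data R us \<epsilon>s J y M \<phi> \<in> measurable \<Omega> (data_space J M)"
  unfolding data_eq_samples data_space_def by (intro measurable_restrict measurable_sample)

text \<open>Independence makes the law a product. Each factor is transported from the copy to the
  original pair by equality in law, where independence of input and noise splits it. The condition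
  \<open>M \<ge> 1\<close> makes the index set of the product nonempty.\<close>

lemma distr_data:
  fixes J :: "nat set" and p :: "(nat \<Rightarrow> real) \<Rightarrow> real"
  assumes \<phi>: "\<phi> \<in> L2 \<rho>" and M: "M \<ge> 1"
    and p: "distributed \<Omega> (\<Pi>\<^sub>M i\<in>J. lborel) (\<lambda>\<omega>. \<lambda>i\<in>J. \<epsilon> (y i) \<omega>) (\<lambda>x. ennreal (p x))"
  shows "distr \<Omega> (data_space J M) (data R us \<epsilon>s J y M \<phi>)
      = (\<Pi>\<^sub>M m\<in>{1..M}. signal_plus_noise (distr \<Omega> borel u) J p (signal \<phi>))"
proof -
  let ?N = "borel \<Otimes>\<^sub>M (\<Pi>\<^sub>M i\<in>J. borel) :: ('x \<times> (nat \<Rightarrow> real)) measure"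
  let ?\<mu> = "distr \<Omega> borel u" and ?\<Lambda> = "\<Pi>\<^sub>M i\<in>J. (lborel :: real measure)"
  let ?G = "sample_map J \<phi>"
  note G = measurable_sample_map[OF \<phi>, of J]
  have u\<epsilon>: "(\<lambda>\<omega>. (u \<omega>, \<lambda>z. \<epsilon> z \<omega>)) \<in> measurable \<Omega> pair_space"
    unfolding pair_space_def by (intro measurable_Pair u measurable_noise_family)
  have distrX: "distr \<Omega> ?N (sample J \<phi> m) = signal_plus_noise ?\<mu> J p (signal \<phi>)" if m: "m \<in> {1..M}" for m
  proof -
    have um: "(\<lambda>\<omega>. (us m \<omega>, \<lambda>z. \<epsilon>s m z \<omega>)) \<in> measurable \<Omega> pair_space"
      using iid m by (auto simp: iid_copies_def indep_vars_def)
    have "distr \<Omega> ?N (sample J \<phi> m) = distr (distr \<Omega> pair_space (\<lambda>\<omega>. (us m \<omega>, \<lambda>z. \<epsilon>s m z \<omega>))) ?N ?G"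
      by (subst distr_distr[OF G um]) (simp add: sample_def[abs_def] comp_def)
    also have "distr \<Omega> pair_space (\<lambda>\<omega>. (us m \<omega>, \<lambda>z. \<epsilon>s m z \<omega>)) = distr \<Omega> pair_space (\<lambda>\<omega>. (u \<omega>, \<lambda>z. \<epsilon> z \<omega>))"
      using iid m by (simp add: iid_copies_def)
    also have "distr \<dots> ?N ?G = distr \<Omega> ?N (\<lambda>\<omega>. ?G (u \<omega>, \<lambda>z. \<epsilon> z \<omega>))"
      by (subst distr_distr[OF G u\<epsilon>]) (simp add: comp_def)
    \<comment> \<open>Adding the signal to the observed noise is \<open>shift_by\<close>; the target
      spaces agree because \<open>borel\<close> and \<open>lborel\<close> have the same measurable
      sets.\<close>
    also have "\<dots> = distr \<Omega> (?\<mu> \<Otimes>\<^sub>M ?\<Lambda>) ((\<lambda>(x, e). (x, shift_by J (signal \<phi> x) e)) \<circ> (\<lambda>\<omega>. (u \<omega>, \<lambda>i\<in>J. \<epsilon> (y i) \<omega>)))"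
      by (intro distr_cong refl sets_pair_measure_cong sets_PiM_cong)
         (auto simp: sample_map_def shift_by_def fun_eq_iff)
    also have "\<dots> = distr (distr \<Omega> (borel \<Otimes>\<^sub>M ?\<Lambda>) (\<lambda>\<omega>. (u \<omega>, \<lambda>i\<in>J. \<epsilon> (y i) \<omega>))) (?\<mu> \<Otimes>\<^sub>M ?\<Lambda>)
        (\<lambda>(x, e). (x, shift_by J (signal \<phi> x) e))"
    proof (rule distr_distr[symmetric])
      note [measurable] = measurable_signal[OF \<phi>]
      show "(\<lambda>(x, e). (x, shift_by J (signal \<phi> x) e)) \<in> measurable (borel \<Otimes>\<^sub>M ?\<Lambda>) (?\<mu> \<Otimes>\<^sub>M ?\<Lambda>)"
        by measurable
      show "(\<lambda>\<omega>. (u \<omega>, \<lambda>i\<in>J. \<epsilon> (y i) \<omega>)) \<in> measurable \<Omega> (borel \<Otimes>\<^sub>M ?\<Lambda>)"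
        using p by (intro measurable_Pair u) (rule distributed_measurable)
    qed
    also have "distr \<Omega> (borel \<Otimes>\<^sub>M ?\<Lambda>) (\<lambda>\<omega>. (u \<omega>, \<lambda>i\<in>J. \<epsilon> (y i) \<omega>)) = ?\<mu> \<Otimes>\<^sub>M density ?\<Lambda> p"
      unfolding distr_input_noise distributed_distr_eq_density[OF p] ..
    finally show ?thesis by (simp add: signal_plus_noise_def)
  qed
  have "distr \<Omega> (\<Pi>\<^sub>M m\<in>{1..M}. ?N) (\<lambda>\<omega>. \<lambda>m\<in>{1..M}. sample J \<phi> m \<omega>) = (\<Pi>\<^sub>M m\<in>{1..M}. distr \<Omega> ?N (sample J \<phi> m))"
    using indep_vars_samples[OF \<phi>, of J M] M measurable_sample[OF \<phi>] by (subst (asm) indep_vars_iff_distr_eq_PiM') auto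
  also have "\<dots> = (\<Pi>\<^sub>M m\<in>{1..M}. signal_plus_noise ?\<mu> J p (signal \<phi>))"
    by (intro PiM_cong refl distrX)
  finally show "distr \<Omega> (data_space J M) (data R us \<epsilon>s J y M \<phi>)
      = (\<Pi>\<^sub>M m\<in>{1..M}. signal_plus_noise (distr \<Omega> borel u) J p (signal \<phi>))"
    by (simp add: data_eq_samples data_space_def)
qed

section \<open>Closeness of the data laws of two kernels\<close>

lemma measure_cylinder_diff_le:
  assumes \<phi>: "\<phi> \<in> L2 \<rho>" "\<phi>' \<in> L2 \<rho>" and M: "M \<ge> 1" and s: "s > 0"
    and N: "N \<ge> 1" "{1..N} \<subseteq> I" and B: "B \<in> sets (data_space {1..N} M)"
  defines "\<zeta> \<equiv> \<lambda>x. \<phi> x - \<phi>' x"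
  shows "measure (distr \<Omega> (data_space {1..N} M) (data R us \<epsilon>s {1..N} y M \<phi>)) B
      - measure (distr \<Omega> (data_space {1..N} M) (data R us \<epsilon>s {1..N} y M \<phi>')) B
      \<le> M * (\<tau> / 2 * l2_inner \<rho> (Lop \<zeta>) \<zeta>) / s + s / 8"
proof -
  let ?J = "{1..N}" and ?\<mu> = "distr \<Omega> borel u"
  have "\<exists>p. (\<forall>x. 0 \<le> p x) \<and>
      distributed \<Omega> (\<Pi>\<^sub>M i\<in>?J. lborel) (\<lambda>\<omega>. \<lambda>i\<in>?J. \<epsilon> (y i) \<omega>) (\<lambda>x. ennreal (p x)) \<and>
      (\<forall>v. (AE x in \<Pi>\<^sub>M i\<in>?J. lborel. 0 < p x \<longrightarrow> 0 < p (shift_by ?J v x)) \<and>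
        integrable (\<Pi>\<^sub>M i\<in>?J. lborel) (\<lambda>x. ln (p x / p (shift_by ?J v x)) * p x) \<and>
        (\<integral>x. ln (p x / p (shift_by ?J v x)) * p x \<partial>(\<Pi>\<^sub>M i\<in>?J. lborel)) \<le> \<tau> / 2 * (\<Sum>i=1..N. (v i)\<^sup>2))"
    unfolding shift_by_def
    using dens[unfolded noise_density_bound_def Let_def, THEN spec, THEN mp, OF N(1), THEN mp, OF N(2)] .
  then obtain p :: "(nat \<Rightarrow> real) \<Rightarrow> real" where p0: "\<And>x. 0 \<le> p x"
    and p: "distributed \<Omega> (\<Pi>\<^sub>M i\<in>?J. lborel) (\<lambda>\<omega>. \<lambda>i\<in>?J. \<epsilon> (y i) \<omega>) (\<lambda>x. ennreal (p x))"
    and ac: "\<And>v. AE x in \<Pi>\<^sub>M i\<in>?J. lborel. 0 < p x \<longrightarrow> 0 < p (shift_by ?J v x)"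
    and int: "\<And>v. integrable (\<Pi>\<^sub>M i\<in>?J. lborel) (\<lambda>x. ln (p x / p (shift_by ?J v x)) * p x)"
    and le: "\<And>v. (\<integral>x. ln (p x / p (shift_by ?J v x)) * p x \<partial>(\<Pi>\<^sub>M i\<in>?J. lborel)) \<le> \<tau> / 2 * (\<Sum>i\<in>?J. (v i)\<^sup>2)"
    by blast
  interpret \<mu>: prob_space ?\<mu> by (intro prob_space_distr u)
  interpret \<nu>: prob_space "density (\<Pi>\<^sub>M i\<in>?J. lborel) (\<lambda>z. ennreal (p z))"
    using prob_space_distr[OF distributed_measurable[OF p]] distributed_distr_eq_density[OF p] by simp
  interpret kl_noise_density ?\<mu> ?J p \<tau>
  proof unfold_locales
    show "p \<in> borel_measurable (\<Pi>\<^sub>M i\<in>?J. lborel)" by (rule distributed_real_measurable[OF p0 p])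
  qed (fact ac int le p0 | simp add: less_imp_le[OF \<tau>])+
  have w: "(\<lambda>x. signal \<phi> x i) \<in> borel_measurable ?\<mu>" "(\<lambda>x. signal \<phi>' x i) \<in> borel_measurable ?\<mu>" for i
    using measurable_signal \<phi> by simp_all
  note int = integrable_signal_diff[of ?J, OF _ N(2) \<phi>]
  let ?K = "signal_plus_noise ?\<mu> ?J p (signal \<phi>)" and ?K' = "signal_plus_noise ?\<mu> ?J p (signal \<phi>')"
  have B': "B \<in> sets (\<Pi>\<^sub>M m\<in>{1..M}. ?K)"
    using B by (subst distr_data[OF \<phi>(1) M p, symmetric]) simp
  have "measure (\<Pi>\<^sub>M m\<in>{1..M}. ?K) B - measure (\<Pi>\<^sub>M m\<in>{1..M}. ?K') B
    \<le> card {1..M} * (\<tau> / 2 * l2_inner \<rho> (Lop \<zeta>) \<zeta>) / s + s / 8"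
  proof (rule prob_diff_PiM_le[where \<rho>="lik_ratio (signal \<phi>) (signal \<phi>')"])
    show "prob_space ?K" "prob_space ?K'" by (intro prob_space_signal_plus_noise w)+
    show "sets ?K' = sets ?K" by (simp only: sets_signal_plus_noise)
    show "lik_ratio (signal \<phi>) (signal \<phi>') \<in> borel_measurable ?K"
      unfolding measurable_cong_sets[OF sets_signal_plus_noise refl] by (rule measurable_lik_ratio) (rule w)+
    show "AE x in ?K. 0 < lik_ratio (signal \<phi>) (signal \<phi>') x"
      by (rule AE_lik_ratio_pos[OF w int]) simp
    show "integrable ?K (\<lambda>x. ln (lik_ratio (signal \<phi>) (signal \<phi>') x))"
      by (rule integrable_ln_lik_ratio[OF w int]) simp
    have "(\<integral>x. - ln (lik_ratio (signal \<phi>) (signal \<phi>') x) \<partial>?K)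
        \<le> \<tau> / 2 * (\<integral>x. (\<Sum>i\<in>?J. (signal \<phi> x i - signal \<phi>' x i)\<^sup>2) \<partial>?\<mu>)"
      by (rule integral_ln_lik_ratio[OF w int]) simp
    also have "\<dots> \<le> \<tau> / 2 * l2_inner \<rho> (Lop \<zeta>) \<zeta>"
      using integral_signal_diff_le[of ?J, OF _ N(2) \<phi>] \<tau> unfolding \<zeta>_def by (intro mult_left_mono) auto
    finally show "(\<integral>x. - ln (lik_ratio (signal \<phi>) (signal \<phi>') x) \<partial>?K) \<le> \<tau> / 2 * l2_inner \<rho> (Lop \<zeta>) \<zeta>" .
    show "(\<integral>\<^sup>+ x. H x * ennreal (lik_ratio (signal \<phi>) (signal \<phi>') x) \<partial>?K) \<le> (\<integral>\<^sup>+ x. H x \<partial>?K')"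
      if "H \<in> borel_measurable ?K" for H
      using that unfolding measurable_cong_sets[OF sets_signal_plus_noise refl]
      by (intro nn_integral_lik_ratio_le w)
  qed (use B' s in auto)
  then show ?thesis
    unfolding distr_data[OF \<phi>(1) M p] distr_data[OF \<phi>(2) M p] by simp
qed

text \<open>The bound on cylinders does not involve the truncation level, so it extends from the
  cylinder algebra to every event of the data, in finite as well as in infinite dimension.\<close>

lemma prob_data_diff_le:
  assumes \<phi>: "\<phi> \<in> L2 \<rho>" "\<phi>' \<in> L2 \<rho>" and M: "M \<ge> 1" and s: "s > 0"
    and I: "I \<noteq> {}" and A: "A \<in> sets (data_space I M)"
  defines "\<zeta> \<equiv> \<lambda>x. \<phi> x - \<phi>' x"
  shows "prob (data R us \<epsilon>s I y M \<phi> -` A \<inter> space \<Omega>) - prob (data R us \<epsilon>s I y M \<phi>' -` A \<inter> space \<Omega>)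
      \<le> M * (\<tau> / 2 * l2_inner \<rho> (Lop \<zeta>) \<zeta>) / s + s / 8"
proof -
  \<comment> \<open>Intersecting with \<open>I\<close> treats both shapes of \<open>I\<close> at
    once. Every \<open>J N\<close> is an initial segment, as (B2) demands, and \<open>Suc\<close>
    together with \<open>I \<noteq> {}\<close> keeps it nonempty.\<close>
  define J where "J N = {1..Suc N} \<inter> I" for N
  have I1: "I \<subseteq> {1..}" using onb by (auto simp: orthonormal_basis_def)
  have J: "incseq J" "(\<Union>N. J N) = I" "J N \<subseteq> I" for N
  proof -
    show "incseq J" by (rule incseq_SucI) (auto simp: J_def)
    show sub: "J N \<subseteq> I" for N by (auto simp: J_def)
    have "i \<in> J i" if "i \<in> I" for i using that I1 by (auto simp: J_def)
    then show "(\<Union>N. J N) = I" using sub by blast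
  qed
  have J_eq: "\<exists>n\<ge>1. J N = {1..n}" for N
  proof -
    consider n where "I = {1..n}" | "I = {1..}" using onb by (auto simp: orthonormal_basis_def)
    then show ?thesis
    proof cases
      case 1
      then show ?thesis using I by (intro exI[of _ "min (Suc N) n"]) (auto simp: J_def)
    next
      case 2
      then show ?thesis by (intro exI[of _ "Suc N"]) (auto simp: J_def)
    qed
  qed
  let ?D = "data_space I M :: (nat \<Rightarrow> 'x \<times> (nat \<Rightarrow> real)) measure"
  let ?P = "\<lambda>\<phi>. distr \<Omega> ?D (data R us \<epsilon>s I y M \<phi>)"
  have fin: "finite_measure (?P \<phi>)" if "\<phi> \<in> L2 \<rho>" for \<phi>
    using prob_space_distr[OF measurable_data[OF that, of I M]] by (rule prob_space.finite_measure)
  have sets: "sets (?P \<phi>) = sigma_sets (space ?D) (cylinders J I M)" for \<phi>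
    by (simp add: sigma_sets_cylinders[OF J(1,2)])
  have "measure (?P \<phi>) B - measure (?P \<phi>') B \<le> M * (\<tau> / 2 * l2_inner \<rho> (Lop \<zeta>) \<zeta>) / s + s / 8"
    if B: "B \<in> cylinders J I M" for B
  proof -
    from B obtain N C where C: "C \<in> sets (data_space (J N) M)"
      and B_eq: "B = truncate_data (J N) M -` C \<inter> space ?D" by (auto simp: cylinders_def)
    have "measure (?P \<phi>) B = measure (distr \<Omega> (data_space (J N) M) (data R us \<epsilon>s (J N) y M \<phi>)) C"
      if \<phi>: "\<phi> \<in> L2 \<rho>" for \<phi>
    proof -
      have "measure (?P \<phi>) B = measure (distr (?P \<phi>) (data_space (J N) M) (truncate_data (J N) M)) C"
        using C measurable_truncate_data[OF J(3), of N M] by (subst measure_distr) (auto simp: B_eq)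
      also have "distr (?P \<phi>) (data_space (J N) M) (truncate_data (J N) M)
          = distr \<Omega> (data_space (J N) M) (data R us \<epsilon>s (J N) y M \<phi>)"
        by (subst distr_distr[OF measurable_truncate_data[OF J(3)] measurable_data[OF \<phi>]])
           (simp add: comp_def truncate_data_data[OF J(3)])
      finally show ?thesis .
    qed
    moreover obtain n where n: "n \<ge> 1" "J N = {1..n}" using J_eq by blast
    ultimately show ?thesis
      using measure_cylinder_diff_le[OF \<phi> M s n(1), of C] C J(3)[of N] \<phi> unfolding \<zeta>_def by auto
  qed
  from measure_diff_le_of_algebra[OF algebra_cylinders[OF J(1,2)] fin[OF \<phi>(1)] sets fin[OF \<phi>(2)] sets this]
  have "measure (?P \<phi>) A - measure (?P \<phi>') A \<le> M * (\<tau> / 2 * l2_inner \<rho> (Lop \<zeta>) \<zeta>) / s + s / 8"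
    using A by (simp add: sigma_sets_cylinders[OF J(1,2)])
  then show ?thesis
    using A measurable_data \<phi> by (simp add: measure_distr)
qed

end

section \<open>Assouad's hypercube\<close>

context regression_model
begin

lemma lam_pos: "k \<ge> 1 \<Longrightarrow> 0 < lam k"
  using eig unfolding positive_eigensystem_def by blast

lemma orthonormal_eigenfunctions: "K \<subseteq> {1..} \<Longrightarrow> orthonormal_family \<rho> K \<psi>"
  using eig unfolding positive_eigensystem_def orthonormal_family_def by (metis atLeast_iff subsetD)

lemma eigenfunction_L2: "k \<ge> 1 \<Longrightarrow> \<psi> k \<in> L2 \<rho>"
  using eig unfolding positive_eigensystem_def by blast

lemma eigenfunction_unit: "k \<ge> 1 \<Longrightarrow> l2_inner \<rho> (\<psi> k) (\<psi> k) = 1"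
  using eig unfolding positive_eigensystem_def by simp

lemma normal_operator_eq:
  "\<phi> \<in> L2 \<rho> \<Longrightarrow> l2_inner \<rho> (Lop \<phi>) \<phi> = (\<integral>\<omega>. R \<phi> (u \<omega>) \<bullet> R \<phi> (u \<omega>) \<partial>\<Omega>)"
  using normal unfolding is_normal_operator_def by blast

lemma R_scale:
  assumes "\<phi> \<in> L2 \<rho>"
  shows "R (\<lambda>x. c * \<phi> x) v = c *\<^sub>R R \<phi> v"
proof -
  have "R (\<lambda>x. c * \<phi> x + 0 * \<phi> x) v = c *\<^sub>R R \<phi> v + 0 *\<^sub>R R \<phi> v"
    using forward assms unfolding forward_operator_def by blast
  then show ?thesis by simp
qed

text \<open>The scalar is extracted through \<open>R\<close>, which is linear pointwise; the
  eigenvalue equation holds only almost everywhere, which is enough under the integral.\<close>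

lemma normal_operator_eigenfunction:
  assumes k: "k \<ge> 1"
  shows "l2_inner \<rho> (Lop (\<lambda>x. c * \<psi> k x)) (\<lambda>x. c * \<psi> k x) = c\<^sup>2 * lam k"
proof -
  note \<psi> = eigenfunction_L2[OF k]
  have L\<psi>: "Lop (\<psi> k) \<in> L2 \<rho>" using normal \<psi> unfolding is_normal_operator_def by blast
  have ae: "AE x in \<rho>. Lop (\<psi> k) x = lam k * \<psi> k x"
    using eig k unfolding positive_eigensystem_def by blast
  note [measurable] = L2_measurable[OF \<psi>] L2_measurable[OF L\<psi>]
  have "l2_inner \<rho> (Lop (\<psi> k)) (\<psi> k) = (\<integral>x. lam k * (\<psi> k x * \<psi> k x) \<partial>\<rho>)"
    unfolding l2_inner_def using ae by (intro integral_cong_AE) (auto elim!: eventually_mono)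
  also have "\<dots> = lam k" using eigenfunction_unit[OF k] by (simp add: l2_inner_def)
  finally have lam: "(\<integral>\<omega>. R (\<psi> k) (u \<omega>) \<bullet> R (\<psi> k) (u \<omega>) \<partial>\<Omega>) = lam k"
    by (simp add: normal_operator_eq[OF \<psi>])
  have "(\<lambda>x. c * \<psi> k x) \<in> L2 \<rho>" using L2_lincomb[OF \<psi> \<psi>, of c 0] by simp
  from normal_operator_eq[OF this]
  have "l2_inner \<rho> (Lop (\<lambda>x. c * \<psi> k x)) (\<lambda>x. c * \<psi> k x) = (\<integral>\<omega>. c\<^sup>2 * (R (\<psi> k) (u \<omega>) \<bullet> R (\<psi> k) (u \<omega>)) \<partial>\<Omega>)"
    by (simp add: R_scale[OF \<psi>] power2_eq_square mult.assoc)
  also have "\<dots> = c\<^sup>2 * lam k" by (simp add: lam)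
  finally show ?thesis .
qed

text \<open>In a zero-dimensional output space every signal would vanish, and with it the first
  eigenvalue.\<close>

lemma I_nonempty: "I \<noteq> {}"
proof
  assume "I = {}"
  then have "(UNIV :: 'y set) = {0}" using onb by (simp add: orthonormal_basis_def closure_closed)
  then have "x = 0" for x :: 'y by blast
  then have "R (\<psi> 1) (u \<omega>) \<bullet> R (\<psi> 1) (u \<omega>) = 0" for \<omega> by simp
  then show False
    using normal_operator_eigenfunction[of 1 1] normal_operator_eq[OF eigenfunction_L2, of 1] lam_pos[of 1] by simp
qed

text \<open>Signs are encoded by the set of frequencies that carry a plus. The hypercube is thus
  \<open>Pow K\<close>, and a flip of one sign inserts or deletes an element.\<close>

definition vertex :: "nat set \<Rightarrow> (nat \<Rightarrow> real) \<Rightarrow> nat set \<Rightarrow> 'd \<Rightarrow> real" where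
  "vertex K c s = (\<lambda>x. \<Sum>k\<in>K. (if k \<in> s then c k else - c k) * \<psi> k x)"

lemma vertex_L2: "finite K \<Longrightarrow> K \<subseteq> {1..} \<Longrightarrow> vertex K c s \<in> L2 \<rho>"
  unfolding vertex_def by (intro L2_sum eigenfunction_L2) auto

lemma prob_vertex_diff_le:
  assumes K: "finite K" "K \<subseteq> {1..}" and M: "M \<ge> 1" and k: "k \<in> K" "k \<in> s"
    and A: "A \<in> sets (data_space I M)" and c: "M * \<tau> * lam k * (c k)\<^sup>2 \<le> 1 / 4"
  shows "prob (data R us \<epsilon>s I y M (vertex K c s) -` A \<inter> space \<Omega>)
      - prob (data R us \<epsilon>s I y M (vertex K c (s - {k})) -` A \<inter> space \<Omega>) \<le> 1 / 2"
proof -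
  let ?\<zeta> = "\<lambda>x. vertex K c s x - vertex K c (s - {k}) x"
  have "?\<zeta> x = 2 * c k * \<psi> k x" for x
  proof -
    have "?\<zeta> x = (\<Sum>j\<in>K. if j = k then 2 * c k * \<psi> k x else 0)"
      unfolding vertex_def sum_subtractf[symmetric] using k by (intro sum.cong) auto
    then show ?thesis using K k by simp
  qed
  then have "l2_inner \<rho> (Lop ?\<zeta>) ?\<zeta> = (2 * c k)\<^sup>2 * lam k"
    using normal_operator_eigenfunction[of k "2 * c k"] k K by auto
  \<comment> \<open>With \<open>s = 2\<close> the entropy term is
    \<open>M * \<tau> * lam k * (c k)^2\<close>, at most 1/4 by assumption, and \<open>s / 8\<close>
    is the other 1/4.\<close>
  with prob_data_diff_le[OF vertex_L2[OF K] vertex_L2[OF K] M _ I_nonempty A, of 2 c s c "s - {k}"]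
  show ?thesis using c by (simp add: power2_eq_square algebra_simps)
qed

text \<open>The sign of the coefficient of \<open>f\<close> along \<open>\<psi> k\<close> serves as
  a guess for the sign in the vertex, with 0 counted as minus. A wrong guess means that the
  coefficient is off by at least \<open>c k\<close>; Bessel's inequality adds up these
  errors.\<close>

lemma l2_dist_vertex_ge:
  assumes K: "finite K" "K \<subseteq> {1..}" and f: "f \<in> L2 \<rho>" and c: "\<And>k. k \<in> K \<Longrightarrow> c k > 0"
  shows "(\<Sum>k\<in>K. (c k)\<^sup>2 * (if (0 < l2_inner \<rho> f (\<psi> k)) = (k \<in> s) then 0 else 1)) \<le> (l2_dist \<rho> f (vertex K c s))\<^sup>2"
proof -
  let ?v = "vertex K c s"
  note v = vertex_L2[OF K, of c s] and on = orthonormal_eigenfunctions[OF K(2)]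
  have "(c k)\<^sup>2 * (if (0 < l2_inner \<rho> f (\<psi> k)) = (k \<in> s) then 0 else 1)
      \<le> (l2_inner \<rho> (\<lambda>x. f x - ?v x) (\<psi> k))\<^sup>2" if k: "k \<in> K" for k
  proof -
    have "\<psi> k \<in> L2 \<rho>" using K k by (intro eigenfunction_L2) auto
    then have *: "l2_inner \<rho> (\<lambda>x. f x - ?v x) (\<psi> k) = l2_inner \<rho> f (\<psi> k) - (if k \<in> s then c k else - c k)"
      using l2_inner_diff_left[OF f v] l2_inner_sum_orthonormal[OF on K(1) k] by (simp add: vertex_def)
    show ?thesis
      unfolding * using c[OF k] by (auto simp: abs_le_square_iff[symmetric])
  qed
  then have "(\<Sum>k\<in>K. (c k)\<^sup>2 * (if (0 < l2_inner \<rho> f (\<psi> k)) = (k \<in> s) then 0 else 1))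
      \<le> (\<Sum>k\<in>K. (l2_inner \<rho> (\<lambda>x. f x - ?v x) (\<psi> k))\<^sup>2)" by (intro sum_mono)
  also have "\<dots> \<le> (l2_dist \<rho> f ?v)\<^sup>2"
    unfolding l2_dist_def l2_norm_squared by (intro l2_bessel on K L2_diff f v)
  finally show ?thesis .
qed

text \<open>A vertex that is bad for one frequency may be harmless for another, so one averages over
  all vertices: for each \<open>k\<close> they pair up into neighbours differing in that sign, whose
  two error probabilities sum to at least 1/2. The mean error is then at least 1/4 for all
  \<open>k\<close> simultaneously, and some vertex is no better than the mean.\<close>

lemma ex_hard_vertex:
  assumes K: "finite K" "K \<subseteq> {1..}" and M: "M \<ge> 1"
    and c: "\<And>k. k \<in> K \<Longrightarrow> M * \<tau> * lam k * (c k)\<^sup>2 \<le> 1 / 4"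
    and A: "\<And>k. k \<in> K \<Longrightarrow> A k \<in> sets (data_space I M)"
  defines "Q \<equiv> \<lambda>s k. prob (data R us \<epsilon>s I y M (vertex K c s) -` A k \<inter> space \<Omega>)"
  shows "\<exists>s. (\<Sum>k\<in>K. (c k)\<^sup>2) / 4 \<le> (\<Sum>k\<in>K. (c k)\<^sup>2 * (if k \<in> s then 1 - Q s k else Q s k))"
proof (rule ccontr)
  define err where "err s k = (if k \<in> s then 1 - Q s k else Q s k)" for s k
  define flip where "flip k s = (if k \<in> s then s - {k} else insert k s)" for k and s :: "nat set"
  assume "\<not> ?thesis"
  then have less: "(\<Sum>k\<in>K. (c k)\<^sup>2 * err s k) < (\<Sum>k\<in>K. (c k)\<^sup>2) / 4" for s
    by (simp add: err_def not_le)
  have pair: "1 / 2 \<le> err s k + err (flip k s) k" if k: "k \<in> K" for s k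
  proof (cases "k \<in> s")
    case True
    with prob_vertex_diff_le[where c=c, OF K M k True A[OF k] c[OF k]] show ?thesis
      by (simp add: err_def flip_def Q_def)
  next
    case False
    with prob_vertex_diff_le[where c=c, OF K M k insertI1 A[OF k] c[OF k], of s] show ?thesis
      by (simp add: err_def flip_def Q_def)
  qed
  have half: "2 ^ card K / 4 \<le> (\<Sum>s\<in>Pow K. err s k)" if k: "k \<in> K" for k
  proof -
    \<comment> \<open>Flipping one sign is an involution of the hypercube, so summing over
      neighbours counts each vertex twice.\<close>
    have "bij_betw (flip k) (Pow K) (Pow K)"
      using k by (intro bij_betwI[where g="flip k"]) (auto simp: flip_def insert_absorb split: if_splits)
    then have "(\<Sum>s\<in>Pow K. err (flip k s) k) = (\<Sum>s\<in>Pow K. err s k)"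
      by (rule sum.reindex_bij_betw)
    then have "2 * (\<Sum>s\<in>Pow K. err s k) = (\<Sum>s\<in>Pow K. err s k + err (flip k s) k)"
      by (simp add: sum.distrib)
    also have "\<dots> \<ge> (\<Sum>s\<in>Pow K. 1 / 2)" by (intro sum_mono pair k)
    finally show ?thesis using K by (simp add: card_Pow)
  qed
  have "(\<Sum>s\<in>Pow K. \<Sum>k\<in>K. (c k)\<^sup>2 * err s k) < (\<Sum>s\<in>Pow K. (\<Sum>k\<in>K. (c k)\<^sup>2) / 4)"
    using K less by (intro sum_strict_mono) auto
  also have "\<dots> = (\<Sum>k\<in>K. (c k)\<^sup>2 * (2 ^ card K / 4))"
    using K by (simp add: card_Pow sum_distrib_left mult_ac)
  also have "\<dots> \<le> (\<Sum>k\<in>K. (c k)\<^sup>2 * (\<Sum>s\<in>Pow K. err s k))"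
    by (intro sum_mono mult_left_mono half) auto
  also have "\<dots> = (\<Sum>s\<in>Pow K. \<Sum>k\<in>K. (c k)\<^sup>2 * err s k)"
    unfolding sum_distrib_left by (rule sum.swap)
  finally show False by simp
qed

text \<open>Every estimator yields a family of sign tests, so its risk at a vertex is at least the
  weighted sum of their error probabilities; the hard vertex for these tests depends on the
  estimator, but it lies in the ball.\<close>

lemma minimax_risk_ge:
  assumes K: "finite K" "K \<subseteq> {1..}" and M: "M \<ge> 1" and pos: "\<And>k. k \<in> K \<Longrightarrow> c k > 0"
    and c: "\<And>k. k \<in> K \<Longrightarrow> M * \<tau> * lam k * (c k)\<^sup>2 \<le> 1 / 4"
    and ball: "(\<Sum>k\<in>K. lam k powr (-\<beta>) * (c k)\<^sup>2) \<le> L\<^sup>2"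
  shows "ennreal (M powr \<gamma> * ((\<Sum>k\<in>K. (c k)\<^sup>2) / 4))
    \<le> minimax_risk \<Omega> \<rho> R us \<epsilon>s I y (sobolev_ball \<rho> lam \<psi> \<beta> L) \<gamma> M"
  unfolding minimax_risk_def
proof (rule INF_greatest)
  fix T :: "(nat \<Rightarrow> 'x \<times> (nat \<Rightarrow> real)) \<Rightarrow> 'd \<Rightarrow> real"
  assume "T \<in> estimators \<rho> I M"
  then have T: "T \<in> measurable (data_space I M) (L2_borel \<rho>)" by (simp add: estimators_def)
  \<comment> \<open>The data for which the estimator votes for a plus at frequency
    \<open>k\<close>.\<close>
  define A where "A k = T -` {f \<in> L2 \<rho>. 0 < l2_inner \<rho> f (\<psi> k)} \<inter> space (data_space I M)" for k
  have A: "A k \<in> sets (data_space I M)" if "k \<in> K" for k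
    unfolding A_def using that K(2)
    by (intro measurable_sets[OF T] halfspace_in_L2_borel eigenfunction_L2 eigenfunction_unit) auto
  define D where "D s = data R us \<epsilon>s I y M (vertex K c s)" for s
  have D: "D s \<in> measurable \<Omega> (data_space I M)" for s
    unfolding D_def by (intro measurable_data vertex_L2 K)
  define Q where "Q s k = prob (D s -` A k \<inter> space \<Omega>)" for s k
  obtain s where s: "(\<Sum>k\<in>K. (c k)\<^sup>2) / 4 \<le> (\<Sum>k\<in>K. (c k)\<^sup>2 * (if k \<in> s then 1 - Q s k else Q s k))"
    using ex_hard_vertex[where A=A and c=c, OF K M c A] unfolding Q_def D_def by blast
  \<comment> \<open>The event that the vote at frequency \<open>k\<close> is wrong when the data
    come from the vertex \<open>s\<close>.\<close>
  define W where "W k = (if k \<in> s then space \<Omega> - (D s -` A k \<inter> space \<Omega>) else D s -` A k \<inter> space \<Omega>)" for k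
  have W: "W k \<in> sets \<Omega>" if "k \<in> K" for k
    using measurable_sets[OF D A[OF that]] by (auto simp: W_def)
  have PW: "prob (W k) = (if k \<in> s then 1 - Q s k else Q s k)" if "k \<in> K" for k
    using measurable_sets[OF D A[OF that], of s] by (simp add: W_def Q_def prob_compl)
  have ptw: "(\<Sum>k\<in>K. (c k)\<^sup>2 * indicator (W k) \<omega>) \<le> (l2_dist \<rho> (T (D s \<omega>)) (vertex K c s))\<^sup>2"
    if \<omega>: "\<omega> \<in> space \<Omega>" for \<omega>
  proof -
    have D\<omega>: "D s \<omega> \<in> space (data_space I M)" using measurable_space[OF D \<omega>] .
    have f: "T (D s \<omega>) \<in> L2 \<rho>" using measurable_space[OF T D\<omega>] by (simp add: space_L2_borel)
    have "indicator (W k) \<omega> = (if (0 < l2_inner \<rho> (T (D s \<omega>)) (\<psi> k)) = (k \<in> s) then 0 else 1 :: real)" for k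
      using \<omega> D\<omega> f by (auto simp: W_def A_def indicator_def)
    then show ?thesis using l2_dist_vertex_ge[where c=c, OF K f pos, of s] by simp
  qed
  have "ennreal (M powr \<gamma> * ((\<Sum>k\<in>K. (c k)\<^sup>2) / 4)) \<le> ennreal (M powr \<gamma> * (\<Sum>k\<in>K. (c k)\<^sup>2 * prob (W k)))"
    using s PW by (intro ennreal_leI mult_left_mono) auto
  also have "M powr \<gamma> * (\<Sum>k\<in>K. (c k)\<^sup>2 * prob (W k)) = (\<integral>\<omega>. M powr \<gamma> * (\<Sum>k\<in>K. (c k)\<^sup>2 * indicator (W k) \<omega>) \<partial>\<Omega>)"
    using W by (simp add: Bochner_Integration.integral_sum emeasure_eq_measure)
  also have "ennreal \<dots> = (\<integral>\<^sup>+\<omega>. ennreal (M powr \<gamma> * (\<Sum>k\<in>K. (c k)\<^sup>2 * indicator (W k) \<omega>)) \<partial>\<Omega>)"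
    using W by (intro nn_integral_eq_integral[symmetric])
      (auto intro!: sum_nonneg mult_nonneg_nonneg integrable_mult_right Bochner_Integration.integrable_sum integrable_real_indicator
        simp: emeasure_eq_measure)
  also have "\<dots> \<le> (\<integral>\<^sup>+\<omega>. ennreal (M powr \<gamma> * (l2_dist \<rho> (T (D s \<omega>)) (vertex K c s))\<^sup>2) \<partial>\<Omega>)"
    using ptw by (intro nn_integral_mono ennreal_leI mult_left_mono) auto
  also have "\<dots> \<le> (SUP \<phi>\<in>sobolev_ball \<rho> lam \<psi> \<beta> L.
      \<integral>\<^sup>+\<omega>. ennreal (M powr \<gamma> * (l2_dist \<rho> (T (data R us \<epsilon>s I y M \<phi> \<omega>)) \<phi>)\<^sup>2) \<partial>\<Omega>)"
  proof (rule SUP_upper2)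
    have "(\<Sum>k\<in>K. lam k powr (-\<beta>) * (if k \<in> s then c k else - c k)\<^sup>2) \<le> L\<^sup>2"
      using ball by (simp add: if_distrib[of power2] cong: if_cong)
    then show "vertex K c s \<in> sobolev_ball \<rho> lam \<psi> \<beta> L"
      unfolding vertex_def using K by (intro sum_in_sobolev_ball eigenfunction_L2) auto
  qed (simp add: D_def)
  finally show "ennreal (M powr \<gamma> * ((\<Sum>k\<in>K. (c k)\<^sup>2) / 4)) \<le> (SUP \<phi>\<in>sobolev_ball \<rho> lam \<psi> \<beta> L.
      \<integral>\<^sup>+\<omega>. ennreal (M powr \<gamma> * (l2_dist \<rho> (T (data R us \<epsilon>s I y M \<phi> \<omega>)) \<phi>)\<^sup>2) \<partial>\<Omega>)" .
qed

end

section \<open>Rates\<close>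

lemma powr_antimono_le:
  fixes x y :: real
  shows "0 < x \<Longrightarrow> x \<le> y \<Longrightarrow> 0 \<le> p \<Longrightarrow> y powr (-p) \<le> x powr (-p)"
  by (rule powr_mono2') auto

text \<open>Here \<open>z\<close> is the real solution of
  \<open>z powr D = 4 * M * \<tau> * L^2 * b powr (\<beta> + 1)\<close>, the ideal size of the
  frequency block, and \<open>2 * (z + 1)\<close> bounds every frequency in the rounded block. The
  last bracket tends to \<open>4 powr (-\<gamma>)\<close> as \<open>z\<close> grows; everything else
  is the claimed rate and constant.\<close>

lemma polynomial_rate_identity:
  fixes \<beta> r b \<tau> L M :: real
  assumes "\<beta> > 0" "r > 0" "b > 0" "\<tau> > 0" "L > 0" "M > 0"
  defines "D \<equiv> 2*\<beta>*r + 2*r + 1"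
  defines "\<gamma> \<equiv> 2*\<beta>*r / D"
  defines "z \<equiv> (4 * M * \<tau> * L\<^sup>2 * b powr (\<beta> + 1)) powr (1 / D)"
  shows "M powr \<gamma> * (L\<^sup>2 * (2 * (z + 1)) powr (-(2*\<beta>*r)))
    = 2 powr (-2*\<beta>*r) * (\<tau> * b powr (\<beta> + 1)) powr (-\<gamma>) * L powr ((4*r + 2) / D) * (4 powr (-\<gamma>) * (1 + 1 / z) powr (-2*\<beta>*r))"
proof -
  have D: "D > 0" unfolding D_def using assms by (intro add_nonneg_pos add_nonneg_nonneg) auto
  have z: "z > 0" unfolding z_def using assms by simp
  have "2 * (z + 1) = 2 * z * (1 + 1 / z)" using z by (simp add: field_simps)
  then have 1: "(2 * (z + 1)) powr (-(2*\<beta>*r)) = 2 powr (-(2*\<beta>*r)) * z powr (-(2*\<beta>*r)) * (1 + 1 / z) powr (-(2*\<beta>*r))"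
    using z by (simp add: powr_mult)
  have "z powr (-(2*\<beta>*r)) = (M * (\<tau> * b powr (\<beta> + 1)) * 4 * L\<^sup>2) powr (-\<gamma>)"
    unfolding z_def powr_powr \<gamma>_def by (simp add: mult_ac)
  also have "\<dots> = M powr (-\<gamma>) * (\<tau> * b powr (\<beta> + 1)) powr (-\<gamma>) * 4 powr (-\<gamma>) * (L\<^sup>2) powr (-\<gamma>)"
    using assms by (simp add: powr_mult)
  finally have 2: "z powr (-(2*\<beta>*r)) = \<dots>" .
  have "L\<^sup>2 * (L\<^sup>2) powr (-\<gamma>) = L powr (2 + 2 * (-\<gamma>))"
    using assms(5) unfolding powr_add by (simp add: powr_powr flip: powr_numeral)
  also have "2 + 2 * (-\<gamma>) = (4*r + 2) / D"
    using D unfolding \<gamma>_def D_def by (simp add: field_simps)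
  finally have 3: "L\<^sup>2 * (L\<^sup>2) powr (-\<gamma>) = L powr ((4*r + 2) / D)" .
  have 4: "M powr \<gamma> * M powr (-\<gamma>) = 1" using assms by (simp flip: powr_add)
  have "M powr \<gamma> * (L\<^sup>2 * (2 * (z + 1)) powr (-(2*\<beta>*r)))
      = (M powr \<gamma> * M powr (-\<gamma>)) * (L\<^sup>2 * (L\<^sup>2) powr (-\<gamma>)) * (\<tau> * b powr (\<beta> + 1)) powr (-\<gamma>) * 4 powr (-\<gamma>)
        * 2 powr (-(2*\<beta>*r)) * (1 + 1 / z) powr (-(2*\<beta>*r))"
    unfolding 1 2 by (simp only: mult_ac)
  then show ?thesis unfolding 3 4 by (simp add: mult_ac)
qed

text \<open>The power \<open>(4 * M * \<tau> * L^2) powr (- 1 / (\<beta> + 1))\<close> is the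
  largest eigenvalue allowed by the balanced condition for a single frequency. The factor
  \<open>a / b * exp (-r)\<close> is what may be lost through the gap between the two eigenvalue
  bounds and through rounding the frequency.\<close>

lemma exponential_rate_identity:
  fixes \<beta> r a b \<tau> L M :: real
  assumes "\<beta> > 0" "a > 0" "b > 0" "\<tau> > 0" "L > 0" "M > 0"
  defines "\<gamma> \<equiv> \<beta> / (\<beta> + 1)"
  shows "M powr \<gamma> * (L\<^sup>2 * (a / b * exp (-r) * (4 * M * \<tau> * L\<^sup>2) powr (- 1 / (\<beta> + 1))) powr \<beta>)
    = exp (-\<beta> * r) * (a / b) powr \<beta> * \<tau> powr (-\<gamma>) * L powr (2 / (\<beta> + 1)) * 4 powr (-\<gamma>)"
proof -
  have "((4 * M * \<tau> * L\<^sup>2) powr (- 1 / (\<beta> + 1))) powr \<beta> = (4 * M * \<tau> * L\<^sup>2) powr (-\<gamma>)"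
    unfolding powr_powr \<gamma>_def by simp
  also have "\<dots> = 4 powr (-\<gamma>) * M powr (-\<gamma>) * \<tau> powr (-\<gamma>) * (L\<^sup>2) powr (-\<gamma>)"
    using assms by (simp add: powr_mult)
  finally have 2: "((4 * M * \<tau> * L\<^sup>2) powr (- 1 / (\<beta> + 1))) powr \<beta> = \<dots>" .
  have exp_powr: "exp (-r) powr \<beta> = exp (-\<beta> * r)" by (simp add: powr_def)
  then have 1: "(a / b * exp (-r) * (4 * M * \<tau> * L\<^sup>2) powr (- 1 / (\<beta> + 1))) powr \<beta>
    = (a / b) powr \<beta> * exp (-\<beta> * r) * ((4 * M * \<tau> * L\<^sup>2) powr (- 1 / (\<beta> + 1))) powr \<beta>"
    by (simp only: powr_mult exp_powr)
  have "L\<^sup>2 * (L\<^sup>2) powr (-\<gamma>) = L powr (2 + 2 * (-\<gamma>))"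
    using assms(5) unfolding powr_add by (simp add: powr_powr flip: powr_numeral)
  also have "2 + 2 * (-\<gamma>) = 2 / (\<beta> + 1)"
    using assms unfolding \<gamma>_def by (simp add: field_simps)
  finally have 3: "L\<^sup>2 * (L\<^sup>2) powr (-\<gamma>) = L powr (2 / (\<beta> + 1))" .
  have 4: "M powr \<gamma> * M powr (-\<gamma>) = 1" using assms by (simp flip: powr_add)
  have "M powr \<gamma> * (L\<^sup>2 * (a / b * exp (-r) * (4 * M * \<tau> * L\<^sup>2) powr (- 1 / (\<beta> + 1))) powr \<beta>)
      = (M powr \<gamma> * M powr (-\<gamma>)) * (L\<^sup>2 * (L\<^sup>2) powr (-\<gamma>)) * (a / b) powr \<beta> * exp (-\<beta> * r) * 4 powr (-\<gamma>) * \<tau> powr (-\<gamma>)"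
    unfolding 1 2 by (simp only: mult_ac)
  then show ?thesis unfolding 3 4 by (simp add: mult_ac)
qed

context regression_model
begin

text \<open>The amplitudes of the hypercube are those for which every one of the \<open>card K\<close> coordinates
  uses up the same share of the Sobolev budget \<open>L\<^sup>2\<close>.\<close>

lemma minimax_risk_ge_balanced:
  assumes K: "finite K" "K \<subseteq> {1..}" "K \<noteq> {}" and M: "M \<ge> 1" and L: "L > 0"
    and c: "\<And>k. k \<in> K \<Longrightarrow> 4 * real M * \<tau> * L\<^sup>2 * lam k powr (\<beta> + 1) \<le> card K"
  shows "ennreal (M powr \<gamma> * (L\<^sup>2 * ((\<Sum>k\<in>K. lam k powr \<beta>) / card K)) / 4)
    \<le> minimax_risk \<Omega> \<rho> R us \<epsilon>s I y (sobolev_ball \<rho> lam \<psi> \<beta> L) \<gamma> M"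
proof -
  define c where "c k = L * sqrt (lam k powr \<beta> / card K)" for k
  have card: "card K > 0" using K by (simp add: card_gt_0_iff)
  have lam: "lam k > 0" if "k \<in> K" for k using that K lam_pos by auto
  have c2: "(c k)\<^sup>2 = L\<^sup>2 * (lam k powr \<beta> / card K)" for k
    by (simp add: c_def power_mult_distrib)
  have "ennreal (M powr \<gamma> * ((\<Sum>k\<in>K. (c k)\<^sup>2) / 4))
    \<le> minimax_risk \<Omega> \<rho> R us \<epsilon>s I y (sobolev_ball \<rho> lam \<psi> \<beta> L) \<gamma> M"
  proof (rule minimax_risk_ge[OF K(1,2) M])
    fix k assume k: "k \<in> K"
    show "c k > 0" using lam[OF k] card L by (simp add: c_def)
    have "lam k powr (\<beta> + 1) = lam k powr \<beta> * lam k" using lam[OF k] by (simp add: powr_add)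
    then show "M * \<tau> * lam k * (c k)\<^sup>2 \<le> 1 / 4"
      using assms(6)[OF k] card unfolding c2 by (simp add: field_simps)
  next
    have "(\<Sum>k\<in>K. lam k powr (-\<beta>) * (c k)\<^sup>2) = (\<Sum>k\<in>K. L\<^sup>2 / card K)"
    proof (rule sum.cong[OF refl])
      fix k assume "k \<in> K"
      from lam[OF this] have "lam k powr (-\<beta>) * lam k powr \<beta> = 1" by (simp flip: powr_add)
      then show "lam k powr (-\<beta>) * (c k)\<^sup>2 = L\<^sup>2 / card K" unfolding c2 by (simp add: field_simps)
    qed
    then show "(\<Sum>k\<in>K. lam k powr (-\<beta>) * (c k)\<^sup>2) \<le> L\<^sup>2" using card by simp
  qed
  also have "M powr \<gamma> * ((\<Sum>k\<in>K. (c k)\<^sup>2) / 4) = M powr \<gamma> * (L\<^sup>2 * ((\<Sum>k\<in>K. lam k powr \<beta>) / card K)) / 4"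
    unfolding c2 by (simp add: sum_distrib_left sum_divide_distrib)
  finally show ?thesis .
qed

text \<open>In a block from \<open>n + 1\<close> to \<open>2 * n\<close> all eigenvalues are of the
  same order: the lower end controls the overlap condition, the upper end the size of the
  amplitudes. Doubling the frequency is the source of \<open>2 powr (-2*\<beta>*r)\<close>.\<close>

lemma liminf_minimax_risk_polynomial:
  assumes a: "0 < a" and r: "r > 0" and \<beta>: "\<beta> > 0" and L: "L > 0"
    and lam: "\<And>k. k \<ge> 1 \<Longrightarrow> a * real k powr (-2*r) \<le> lam k \<and> lam k \<le> b * real k powr (-2*r)"
  defines "D \<equiv> 2*\<beta>*r + 2*r + 1"
  defines "\<gamma> \<equiv> 2*\<beta>*r / D"
  shows "ennreal (2 powr (-2*\<beta>*r - 4) * a powr \<beta> * (\<tau> * b powr (\<beta> + 1)) powr (-\<gamma>) * L powr ((4*r + 2) / D))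
    \<le> liminf (minimax_risk \<Omega> \<rho> R us \<epsilon>s I y (sobolev_ball \<rho> lam \<psi> \<beta> L) \<gamma>)"
proof (rule Liminf_bounded)
  have b: "b > 0" using lam[of 1] a by simp
  have D: "D > 0" unfolding D_def using \<beta> r by (intro add_nonneg_pos add_nonneg_nonneg) auto
  have \<gamma>1: "\<gamma> < 1" unfolding \<gamma>_def using D r by (simp add: D_def)
  define x where "x M = 4 * real M * \<tau> * L\<^sup>2 * b powr (\<beta> + 1)" for M
  define z where "z M = x M powr (1 / D)" for M
  have "filterlim (\<lambda>M. (4 * \<tau> * L\<^sup>2 * b powr (\<beta> + 1)) * real M) at_top sequentially"
    using \<tau> L b by (intro filterlim_tendsto_pos_mult_at_top[OF tendsto_const _ filterlim_real_sequentially]) auto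
  then have "filterlim x at_top sequentially" unfolding x_def[abs_def] by (simp add: mult_ac)
  then have z_lim: "filterlim z at_top sequentially"
    unfolding z_def[abs_def] using D by (intro filterlim_compose[OF real_powr_at_top]) auto
  have "((\<lambda>M. 4 powr (-\<gamma>) * (1 + 1 / z M) powr (-2*\<beta>*r)) \<longlongrightarrow> 4 powr (-\<gamma>) * (1 + 0) powr (-2*\<beta>*r)) sequentially"
    using tendsto_divide_0[OF tendsto_const filterlim_at_top_imp_at_infinity[OF z_lim]]
    by (intro tendsto_intros) auto
  \<comment> \<open>The limit is strictly above 1/4 because \<open>\<gamma> < 1\<close>; this margin
    absorbs the rounding factor in \<open>1 + 1 / z M\<close> for all large
    \<open>M\<close>.\<close>
  moreover have "4 powr (-1) < (4::real) powr (-\<gamma>)" using \<gamma>1 by (intro powr_less_mono) auto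
  ultimately have ev: "\<forall>\<^sub>F M in sequentially. 1 / 4 < 4 powr (-\<gamma>) * (1 + 1 / z M) powr (-2*\<beta>*r)"
    by (intro order_tendstoD(1)[where a="1/4"]) auto
  show "\<forall>\<^sub>F M in sequentially. ennreal (2 powr (-2*\<beta>*r - 4) * a powr \<beta> * (\<tau> * b powr (\<beta> + 1)) powr (-\<gamma>) * L powr ((4*r + 2) / D))
    \<le> minimax_risk \<Omega> \<rho> R us \<epsilon>s I y (sobolev_ball \<rho> lam \<psi> \<beta> L) \<gamma> M"
    using ev eventually_ge_at_top[of 1]
  proof eventually_elim
    case (elim M)
    \<comment> \<open>Rounding up secures the overlap condition
      \<open>x M \<le> real n powr D\<close>; the excess of at most 1 reappears as
      \<open>z M + 1\<close>.\<close>
    define n where "n = nat \<lceil>z M\<rceil>"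
    let ?K = "{n+1..2*n}"
    have x: "x M > 0" using elim \<tau> L b by (simp add: x_def)
    then have z: "z M > 0" by (simp add: z_def)
    then have n: "n \<ge> 1" "z M \<le> n" "n \<le> z M + 1" unfolding n_def by linarith+
    have "x M = z M powr D" using x D by (simp add: z_def powr_powr)
    also have "\<dots> \<le> real n powr D" using n z D by (intro powr_mono2) auto
    finally have xn: "x M \<le> real n powr D" .
    have "ennreal (M powr \<gamma> * (L\<^sup>2 * ((\<Sum>k\<in>?K. lam k powr \<beta>) / card ?K)) / 4)
      \<le> minimax_risk \<Omega> \<rho> R us \<epsilon>s I y (sobolev_ball \<rho> lam \<psi> \<beta> L) \<gamma> M"
    proof (rule minimax_risk_ge_balanced)
      fix k assume k: "k \<in> ?K"
      have "lam k \<le> b * real k powr (-(2*r))" using lam[of k] k by simp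
      also have "\<dots> \<le> b * real n powr (-(2*r))"
        using k n b r by (intro mult_left_mono powr_antimono_le) auto
      finally have "lam k powr (\<beta> + 1) \<le> (b * real n powr (-(2*r))) powr (\<beta> + 1)"
        using lam_pos[of k] k \<beta> by (intro powr_mono2) auto
      \<comment> \<open>The exponent \<open>-2*r*(\<beta> + 1)\<close> is \<open>1 - D\<close>;
        multiplied by \<open>real n powr D\<close> this leaves \<open>n\<close>, the number of
        frequencies in the block.\<close>
      also have "\<dots> = b powr (\<beta> + 1) * real n powr (1 - D)"
        using b n by (simp add: powr_mult powr_powr D_def algebra_simps)
      finally have "4 * real M * \<tau> * L\<^sup>2 * lam k powr (\<beta> + 1) \<le> 4 * real M * \<tau> * L\<^sup>2 * (b powr (\<beta> + 1) * real n powr (1 - D))"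
        using \<tau> by (intro mult_left_mono) auto
      also have "\<dots> = x M * real n powr (1 - D)" by (simp add: x_def)
      also have "\<dots> \<le> real n powr D * real n powr (1 - D)" by (intro mult_right_mono xn) auto
      also have "\<dots> = card ?K" using n by (simp flip: powr_add)
      finally show "4 * real M * \<tau> * L\<^sup>2 * lam k powr (\<beta> + 1) \<le> card ?K" .
    qed (use elim n L in auto)
    moreover have "2 powr (-2*\<beta>*r - 4) * a powr \<beta> * (\<tau> * b powr (\<beta> + 1)) powr (-\<gamma>) * L powr ((4*r + 2) / D)
      \<le> M powr \<gamma> * (L\<^sup>2 * ((\<Sum>k\<in>?K. lam k powr \<beta>) / card ?K)) / 4"
    proof -
      have "a powr \<beta> * (2 * (z M + 1)) powr (-(2*\<beta>*r)) \<le> lam k powr \<beta>" if k: "k \<in> ?K" for k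
      proof -
        have "real k \<le> 2 * real n" using k by simp
        also have "\<dots> \<le> 2 * (z M + 1)" using n by simp
        finally have "real k \<le> 2 * (z M + 1)" .
        then have "a * (2 * (z M + 1)) powr (-(2*r)) \<le> a * real k powr (-(2*r))"
          using k n r a by (intro mult_left_mono powr_antimono_le) auto
        also have "\<dots> \<le> lam k" using lam[of k] k by simp
        finally have "(a * (2 * (z M + 1)) powr (-(2*r))) powr \<beta> \<le> lam k powr \<beta>"
          using a \<beta> by (intro powr_mono2) auto
        then show ?thesis using a z by (simp add: powr_mult powr_powr mult_ac)
      qed
      then have "card ?K * (a powr \<beta> * (2 * (z M + 1)) powr (-(2*\<beta>*r))) \<le> (\<Sum>k\<in>?K. lam k powr \<beta>)"
        by (intro sum_bounded_below) auto
      then have "a powr \<beta> * (2 * (z M + 1)) powr (-(2*\<beta>*r)) \<le> (\<Sum>k\<in>?K. lam k powr \<beta>) / card ?K"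
        using n by (simp add: field_simps)
      then have UB: "M powr \<gamma> * (L\<^sup>2 * (a powr \<beta> * (2 * (z M + 1)) powr (-(2*\<beta>*r))))
          \<le> M powr \<gamma> * (L\<^sup>2 * ((\<Sum>k\<in>?K. lam k powr \<beta>) / card ?K))"
        by (intro mult_left_mono) auto
      define W where
        "W = a powr \<beta> * (2 powr (-2*\<beta>*r) * (\<tau> * b powr (\<beta> + 1)) powr (-\<gamma>) * L powr ((4*r + 2) / D))"
      have rate: "M powr \<gamma> * (L\<^sup>2 * (a powr \<beta> * (2 * (z M + 1)) powr (-(2*\<beta>*r))))
        = W * (4 powr (-\<gamma>) * (1 + 1 / z M) powr (-2*\<beta>*r))"
        using polynomial_rate_identity[OF \<beta> r b \<tau> L, of "real M"] elim
        unfolding W_def z_def x_def \<gamma>_def D_def by (simp add: mult_ac)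
      \<comment> \<open>The factor \<open>2 powr (-4)\<close> splits into the quarter of the
        averaging argument and the quarter that bounds the last bracket of the rate identity from
        below.\<close>
      have "2 powr (-2*\<beta>*r - 4) * a powr \<beta> * (\<tau> * b powr (\<beta> + 1)) powr (-\<gamma>) * L powr ((4*r + 2) / D) = W * (1 / 4) / 4"
        unfolding W_def powr_diff by simp
      also have "\<dots> \<le> W * (4 powr (-\<gamma>) * (1 + 1 / z M) powr (-2*\<beta>*r)) / 4"
        using elim unfolding W_def by (intro divide_right_mono mult_left_mono) auto
      also have "\<dots> \<le> M powr \<gamma> * (L\<^sup>2 * ((\<Sum>k\<in>?K. lam k powr \<beta>) / card ?K)) / 4"
        unfolding rate[symmetric] by (intro divide_right_mono UB) simp
      finally show ?thesis .
    qed
    ultimately show ?case by (meson ennreal_leI order_trans)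
  qed
qed

text \<open>Eigenvalues within a block would differ by exponential factors, so the hypercube is
  reduced to two points at the first frequency where the upper bound
  \<open>b * exp (- r * k)\<close> falls to the threshold \<open>z M\<close>.\<close>

lemma liminf_minimax_risk_exponential:
  assumes a: "0 < a" and r: "r > 0" and \<beta>: "\<beta> > 0" and L: "L > 0"
    and lam: "\<And>k. k \<ge> 1 \<Longrightarrow> a * exp (- r * real k) \<le> lam k \<and> lam k \<le> b * exp (- r * real k)"
  defines "\<gamma> \<equiv> \<beta> / (\<beta> + 1)"
  shows "ennreal (1/16 * exp (- \<beta> * r) * (a / b) powr \<beta> * \<tau> powr (-\<gamma>) * L powr (2 / (\<beta> + 1)))
    \<le> liminf (minimax_risk \<Omega> \<rho> R us \<epsilon>s I y (sobolev_ball \<rho> lam \<psi> \<beta> L) \<gamma>)"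
proof (rule Liminf_bounded)
  have "0 < b * exp (- r * 1)" using lam[of 1] mult_pos_pos[OF a, of "exp (- r * 1)"] by simp
  then have b: "b > 0" by (simp add: zero_less_mult_iff)
  define z where "z M = (4 * real M * \<tau> * L\<^sup>2) powr (- 1 / (\<beta> + 1))" for M
  have "filterlim (\<lambda>M. (4 * \<tau> * L\<^sup>2) * real M) at_top sequentially"
    using \<tau> L by (intro filterlim_tendsto_pos_mult_at_top[OF tendsto_const _ filterlim_real_sequentially]) auto
  then have "filterlim (\<lambda>M. 4 * real M * \<tau> * L\<^sup>2) at_top sequentially" by (simp add: mult_ac)
  then have "(z \<longlongrightarrow> 0) sequentially"
    unfolding z_def[abs_def] using \<beta> by (intro tendsto_neg_powr) auto
  \<comment> \<open>The threshold must drop below \<open>b\<close>, since only then is the frequency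
    chosen below at least 1.\<close>
  then have ev: "\<forall>\<^sub>F M in sequentially. z M < b" using b by (rule order_tendstoD(2))
  have \<gamma>: "\<gamma> \<le> 1" unfolding \<gamma>_def using \<beta> by simp
  show "\<forall>\<^sub>F M in sequentially. ennreal (1/16 * exp (- \<beta> * r) * (a / b) powr \<beta> * \<tau> powr (-\<gamma>) * L powr (2 / (\<beta> + 1)))
    \<le> minimax_risk \<Omega> \<rho> R us \<epsilon>s I y (sobolev_ball \<rho> lam \<psi> \<beta> L) \<gamma> M"
    using ev eventually_ge_at_top[of 1]
  proof eventually_elim
    case (elim M)
    have z: "z M > 0" using elim \<tau> L by (simp add: z_def)
    \<comment> \<open>The real solution of \<open>b * exp (- r * t) = z M\<close>; rounding it up
      costs at most a factor \<open>exp (- r)\<close> in the eigenvalue.\<close>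
    define t where "t = ln (b / z M) / r"
    define k where "k = nat \<lceil>t\<rceil>"
    have "t > 0" unfolding t_def using elim z r by simp
    then have k: "k \<ge> 1" "t \<le> k" "k \<le> t + 1" unfolding k_def by linarith+
    have exp_t: "exp (- r * t) = z M / b" unfolding t_def using r z b by (simp add: exp_minus field_simps)
    have "b * exp (- r * k) \<le> b * exp (- r * t)" using k r b by simp
    also have "\<dots> = z M" using exp_t b by simp
    finally have lam_le: "lam k \<le> z M" using lam[OF k(1)] by simp
    have "a * exp (- r * (t + 1)) \<le> a * exp (- r * k)" using k r a by simp
    moreover have "exp (- r * (t + 1)) = exp (- r * t) * exp (- r)" by (simp add: algebra_simps flip: exp_add)
    ultimately have lam_ge: "a / b * exp (- r) * z M \<le> lam k" using lam[OF k(1)] exp_t by (simp add: mult_ac)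
    have "ennreal (M powr \<gamma> * (L\<^sup>2 * ((\<Sum>k\<in>{k}. lam k powr \<beta>) / card {k})) / 4)
      \<le> minimax_risk \<Omega> \<rho> R us \<epsilon>s I y (sobolev_ball \<rho> lam \<psi> \<beta> L) \<gamma> M"
    proof (rule minimax_risk_ge_balanced)
      fix j assume "j \<in> {k}"
      have "lam k powr (\<beta> + 1) \<le> z M powr (\<beta> + 1)"
        using lam_le lam_pos[OF k(1)] \<beta> by (intro powr_mono2) auto
      also have "z M powr (\<beta> + 1) = 1 / (4 * real M * \<tau> * L\<^sup>2)"
        unfolding z_def powr_powr using \<beta> elim \<tau> L by (simp add: powr_minus_divide)
      finally show "4 * real M * \<tau> * L\<^sup>2 * lam j powr (\<beta> + 1) \<le> card {k}"
        using \<open>j \<in> {k}\<close> elim \<tau> L by (simp add: field_simps)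
    qed (use elim k L in auto)
    moreover have "1/16 * exp (- \<beta> * r) * (a / b) powr \<beta> * \<tau> powr (-\<gamma>) * L powr (2 / (\<beta> + 1))
      \<le> M powr \<gamma> * (L\<^sup>2 * ((\<Sum>k\<in>{k}. lam k powr \<beta>) / card {k})) / 4"
    proof -
      have "M powr \<gamma> * (L\<^sup>2 * (a / b * exp (- r) * z M) powr \<beta>) \<le> M powr \<gamma> * (L\<^sup>2 * lam k powr \<beta>)"
        using lam_ge a b z \<beta> by (intro mult_left_mono powr_mono2) auto
      moreover have "M powr \<gamma> * (L\<^sup>2 * (a / b * exp (- r) * z M) powr \<beta>)
        = exp (-\<beta> * r) * (a / b) powr \<beta> * \<tau> powr (-\<gamma>) * L powr (2 / (\<beta> + 1)) * 4 powr (-\<gamma>)"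
        using exponential_rate_identity[OF \<beta> a b \<tau> L, of "real M"] elim unfolding z_def \<gamma>_def by simp
      moreover have "4 powr (-1) \<le> (4::real) powr (-\<gamma>)" using \<gamma> by (intro powr_mono) auto
      then have "exp (-\<beta> * r) * (a / b) powr \<beta> * \<tau> powr (-\<gamma>) * L powr (2 / (\<beta> + 1)) * (1 / 4)
        \<le> exp (-\<beta> * r) * (a / b) powr \<beta> * \<tau> powr (-\<gamma>) * L powr (2 / (\<beta> + 1)) * 4 powr (-\<gamma>)"
        by (intro mult_left_mono) auto
      ultimately show ?thesis by (simp add: mult_ac)
    qed
    ultimately show ?case by (meson ennreal_leI order_trans)
  qed
qed

end


theorem theorem4p1:
  fixes S :: "'d::euclidean_space set"
    and \<rho> :: "'d measure"
    and \<Omega> :: "'w measure"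
    and R :: "('d \<Rightarrow> real) \<Rightarrow> 'x::banach \<Rightarrow> 'y::{real_inner, polish_space}"
    and u :: "'w \<Rightarrow> 'x" and \<epsilon> :: "'y \<Rightarrow> 'w \<Rightarrow> real"
    and us :: "nat \<Rightarrow> 'w \<Rightarrow> 'x" and \<epsilon>s :: "nat \<Rightarrow> 'y \<Rightarrow> 'w \<Rightarrow> real"
    and Lop :: "('d \<Rightarrow> real) \<Rightarrow> ('d \<Rightarrow> real)"
    and lam :: "nat \<Rightarrow> real" and \<psi> :: "nat \<Rightarrow> 'd \<Rightarrow> real"
    and I :: "nat set" and y :: "nat \<Rightarrow> 'y"
    and \<beta> L \<sigma> \<tau> :: real
  assumes "compact S" and "sets \<rho> = sets (restrict_space borel S)"
    and "prob_space \<Omega>" and "complete_measure \<Omega>"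
    and "u \<in> borel_measurable \<Omega>"
    and "forward_operator \<rho> R"
    and "is_normal_operator \<Omega> \<rho> R u Lop"
    and "nonneg_selfadjoint \<rho> Lop" and "compact_operator \<rho> Lop"
    and "positive_eigensystem \<rho> Lop lam \<psi>"
    and "linear_noise \<Omega> \<epsilon>" and "indep_of_input \<Omega> u \<epsilon>"
    and "\<sigma> > 0" and "noise_moments \<Omega> \<epsilon> \<sigma>"
    and "orthonormal_basis I y"
    and "\<tau> > 0" and "noise_density_bound \<Omega> \<epsilon> I y \<tau>"
    and "iid_copies \<Omega> u \<epsilon> us \<epsilon>s"
    and "\<beta> > 0" and "L > 0"
  shows
    "(\<forall>a b r. 0 < a \<and> a \<le> b \<and> r > 1/4 \<and>
        (\<forall>k\<ge>1. a * real k powr (-2*r) \<le> lam k \<and> lam k \<le> b * real k powr (-2*r)) \<longrightarrow>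
        liminf (\<lambda>M. minimax_risk \<Omega> \<rho> R us \<epsilon>s I y (sobolev_ball \<rho> lam \<psi> \<beta> L)
                      (2*\<beta>*r / (2*\<beta>*r + 2*r + 1)) M)
        \<ge> ennreal (2 powr (-2*\<beta>*r - 4) * a powr \<beta>
             * (\<tau> * b powr (\<beta> + 1)) powr (- (2*\<beta>*r / (2*\<beta>*r + 2*r + 1)))
             * L powr ((4*r + 2) / (2*\<beta>*r + 2*r + 1)))) \<and>
     (\<forall>a b r. 0 < a \<and> a \<le> b \<and> r > 0 \<and>
        (\<forall>k\<ge>1. a * exp (- r * real k) \<le> lam k \<and> lam k \<le> b * exp (- r * real k)) \<longrightarrow>
        liminf (\<lambda>M. minimax_risk \<Omega> \<rho> R us \<epsilon>s I y (sobolev_ball \<rho> lam \<psi> \<beta> L)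
                      (\<beta> / (\<beta> + 1)) M)
        \<ge> ennreal (1/16 * exp (- \<beta> * r) * (a / b) powr \<beta>
             * \<tau> powr (- (\<beta> / (\<beta> + 1))) * L powr (2 / (\<beta> + 1))))"
proof -
  interpret prob_space \<Omega> by fact
  interpret regression_model \<Omega> \<rho> R u \<epsilon> us \<epsilon>s Lop I y \<tau> lam \<psi>
    by unfold_locales fact+
  note pos = \<open>\<beta> > 0\<close> \<open>L > 0\<close>
  show ?thesis
    using liminf_minimax_risk_polynomial[OF _ _ pos] liminf_minimax_risk_exponential[OF _ _ pos] by auto
qed

end
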